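(* Let $M=(M_1\times_f M_2)\times_h M_3$ be a sequential warped product equipped with the metric $g=(g_1\oplus f^2g_2)\oplus h^2g_3$, and let $(M,g,X,\lambda,\rho)$ be a Ricci-Bourguignon soliton with $X=X_1+X_2+X_3$, where $X_i\in\mathfrak{X}(M_i)$ for $1\le i\le 3$. Then $(M,g)$ is Einstein if one of the following conditions holds: (i) $X=X_3$ and $X_3$ is a Killing vector field on $(M_3,g_3)$. (ii) $X_1$ is a Killing vector field on $(M_1,g_1)$, and $X_2$ and $X_3$ are conformal vector fields on $(M_2,g_2)$ and $(M_3,g_3)$ with factors $-2X_1(\ln f)$ and $-2(X_1+X_2)(\ln h)$, respectively. (iii) $X=X_2+X_3$, the vector fields $X_2$ and $X_3$ are Killing on $(M_2,g_2)$ and $(M_3,g_3)$, respectively, and $X_2(h)=0$.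
   Context: Let $(M_i,g_i)$, $1\le i\le 3$, be semi-Riemannian manifolds, and let $f:M_1\to\mathbb{R}^+$, $h:M_1\times M_2\to\mathbb{R}^+$ be smooth functions (the warping functions). The sequential warped product $M=(M_1\times_f M_2)\times_h M_3$ is the manifold $M_1\times M_2\times M_3$ with metric $g=(g_1\oplus f^2g_2)\oplus h^2g_3$. Functions and vector fields on the factors are identified with their lifts to $M$. $\mathfrak{X}(M_i)$ is the set of smooth vector fields on $M_i$. A Ricci-Bourguignon soliton $(M,g,X,\lambda,\rho)$ is a semi-Riemannian manifold $(M,g)$ with a vector field $X$ and real constants $\lambda,\rho$ such that $\mathrm{Ric}+\frac12\mathcal{L}_Xg=\lambda g+\rho Rg$, where $R$ is the scalar curvature of $g$. A vector field $V$ on $(N,g_N)$ is Killing if $\mathcal{L}_Vg_N=0$, and conformal with factor $\beta$ if $\mathcal{L}_Vg_N=\beta g_N$. In (ii) the conditions mean $\mathcal{L}_{X_2}g_2=-2X_1(\ln f)\,g_2$ and $\mathcal{L}_{X_3}g_3=-2(X_1+X_2)(\ln h)\,g_3$, all objects being lifted to $M$. $(N,g_N)$ is called Einstein if its Ricci tensor is $\mu g_N$ for some smooth function $\mu$ on $N$ (the factor). *)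

theory Defs
  imports "HOL-Analysis.Analysis"
begin

section \<open>Smooth maps and smooth manifolds\<close>

primrec Ck_on :: "nat \<Rightarrow> 'a::euclidean_space set \<Rightarrow> ('a \<Rightarrow> 'b::real_normed_vector) \<Rightarrow> bool" where
  "Ck_on 0 S f \<longleftrightarrow> continuous_on S f"
| "Ck_on (Suc k) S f \<longleftrightarrow>
     (\<forall>x\<in>S. f differentiable (at x)) \<and> (\<forall>v. Ck_on k S (\<lambda>x. frechet_derivative f (at x) v))"

text \<open>Only used for open sets.\<close>

definition smooth_on :: "'a::euclidean_space set \<Rightarrow> ('a \<Rightarrow> 'b::real_normed_vector) \<Rightarrow> bool" where
  "smooth_on S f \<longleftrightarrow> (\<forall>k. Ck_on k S f)"

text \<open>
  The manifold is the whole (Hausdorff, second countable) type \<open>'m\<close>, of dimension \<open>DIM('e)\<close>. An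
  atlas is a family of charts indexed by the type \<open>'i\<close>; only the values of a coordinate map on the
  chart domain matter. Indexing keeps the two factors of a product chart recoverable.
\<close>

type_synonym ('i, 'm, 'e) atlas = "'i \<Rightarrow> 'm set \<times> ('m \<Rightarrow> 'e)"

definition chart_dom :: "('i, 'm, 'e) atlas \<Rightarrow> 'i \<Rightarrow> 'm set" where
  "chart_dom A i = fst (A i)"

definition coord :: "('i, 'm, 'e) atlas \<Rightarrow> 'i \<Rightarrow> 'm \<Rightarrow> 'e" where
  "coord A i = snd (A i)"

definition chart_ran :: "('i, 'm, 'e) atlas \<Rightarrow> 'i \<Rightarrow> 'e set" where
  "chart_ran A i = coord A i ` chart_dom A i"

definition param :: "('i, 'm, 'e) atlas \<Rightarrow> 'i \<Rightarrow> 'e \<Rightarrow> 'm" where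
  "param A i = inv_into (chart_dom A i) (coord A i)"

definition overlap :: "('i, 'm, 'e) atlas \<Rightarrow> 'i \<Rightarrow> 'i \<Rightarrow> 'e set" where
  "overlap A i j = coord A i ` (chart_dom A i \<inter> chart_dom A j)"

definition transition :: "('i, 'm, 'e) atlas \<Rightarrow> 'i \<Rightarrow> 'i \<Rightarrow> 'e \<Rightarrow> 'e" where
  "transition A i j = coord A j \<circ> param A i"

definition smooth_manifold ::
  "('i, 'm::{t2_space, second_countable_topology}, 'e::euclidean_space) atlas \<Rightarrow> bool" where
  "smooth_manifold A \<longleftrightarrow>
     (\<Union>i. chart_dom A i) = UNIV \<and>
     (\<forall>i. open (chart_dom A i) \<and> open (chart_ran A i) \<and>
          homeomorphism (chart_dom A i) (chart_ran A i) (coord A i) (param A i)) \<and>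
     (\<forall>i j. smooth_on (overlap A i j) (transition A i j))"

definition smooth_fun :: "('i, 'm, 'e::euclidean_space) atlas \<Rightarrow> ('m \<Rightarrow> real) \<Rightarrow> bool" where
  "smooth_fun A f \<longleftrightarrow> (\<forall>i. smooth_on (chart_ran A i) (f \<circ> param A i))"

section \<open>Vector fields and covariant 2-tensor fields\<close>

text \<open>
  A field is given by its local representatives: \<open>X i x\<close> are the components, in the \<open>i\<close>-th chart, of
  the vector field \<open>X\<close> at the point with coordinates \<open>x\<close>, and similarly \<open>T i x u v\<close> for a
  (0,2)-tensor field. Values outside \<open>chart_ran A i\<close> are irrelevant, so fields are compared with
  \<open>vf_eq\<close> and \<open>tensor_eq\<close>.
\<close>

type_synonym ('i, 'e) vfield = "'i \<Rightarrow> 'e \<Rightarrow> 'e"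

type_synonym ('i, 'e) tfield = "'i \<Rightarrow> 'e \<Rightarrow> 'e \<Rightarrow> 'e \<Rightarrow> real"

definition smooth_vfield ::
  "('i, 'm, 'e::euclidean_space) atlas \<Rightarrow> ('i, 'e) vfield \<Rightarrow> bool" where
  "smooth_vfield A X \<longleftrightarrow>
     (\<forall>i. smooth_on (chart_ran A i) (X i)) \<and>
     (\<forall>i j. \<forall>x\<in>overlap A i j.
        X j (transition A i j x) = frechet_derivative (transition A i j) (at x) (X i x))"

definition smooth_tfield ::
  "('i, 'm, 'e::euclidean_space) atlas \<Rightarrow> ('i, 'e) tfield \<Rightarrow> bool" where
  "smooth_tfield A T \<longleftrightarrow>
     (\<forall>i. \<forall>x\<in>chart_ran A i. bilinear (T i x)) \<and>
     (\<forall>i u v. smooth_on (chart_ran A i) (\<lambda>x. T i x u v)) \<and>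
     (\<forall>i j. \<forall>x\<in>overlap A i j. \<forall>u v.
        T j (transition A i j x)
          (frechet_derivative (transition A i j) (at x) u)
          (frechet_derivative (transition A i j) (at x) v) = T i x u v)"

definition vf_eq ::
  "('i, 'm, 'e) atlas \<Rightarrow> ('i, 'e) vfield \<Rightarrow> ('i, 'e) vfield \<Rightarrow> bool" where
  "vf_eq A X Y \<longleftrightarrow> (\<forall>i. \<forall>x\<in>chart_ran A i. X i x = Y i x)"

definition tensor_eq ::
  "('i, 'm, 'e) atlas \<Rightarrow> ('i, 'e) tfield \<Rightarrow> ('i, 'e) tfield \<Rightarrow> bool" where
  "tensor_eq A S T \<longleftrightarrow> (\<forall>i. \<forall>x\<in>chart_ran A i. \<forall>u v. S i x u v = T i x u v)"

definition vf_add :: "('i, 'e::plus) vfield \<Rightarrow> ('i, 'e) vfield \<Rightarrow> ('i, 'e) vfield" where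
  "vf_add X Y = (\<lambda>i x. X i x + Y i x)"

definition tensor_add :: "('i, 'e) tfield \<Rightarrow> ('i, 'e) tfield \<Rightarrow> ('i, 'e) tfield" where
  "tensor_add S T = (\<lambda>i x u v. S i x u v + T i x u v)"

definition tensor_scale ::
  "('i, 'm, 'e) atlas \<Rightarrow> ('m \<Rightarrow> real) \<Rightarrow> ('i, 'e) tfield \<Rightarrow> ('i, 'e) tfield" where
  "tensor_scale A \<beta> T = (\<lambda>i x u v. \<beta> (param A i x) * T i x u v)"

text \<open>
  The function \<open>X(f)\<close>, computed in some chart around the point; for a vector field \<open>X\<close> and a smooth
  function \<open>f\<close> it does not depend on the chart.
\<close>

definition vf_apply ::
  "('i, 'm, 'e::euclidean_space) atlas \<Rightarrow> ('i, 'e) vfield \<Rightarrow> ('m \<Rightarrow> real) \<Rightarrow> 'm \<Rightarrow> real" where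
  "vf_apply A X f p =
     (let i = (SOME i. p \<in> chart_dom A i); x = coord A i p
      in frechet_derivative (f \<circ> param A i) (at x) (X i x))"

section \<open>Semi-Riemannian metrics\<close>

definition form_index :: "('e::euclidean_space \<Rightarrow> 'e \<Rightarrow> real) \<Rightarrow> nat" where
  "form_index B = Max {dim S | S. subspace S \<and> (\<forall>v\<in>S - {0}. B v v < 0)}"

definition semi_riemannian ::
  "('i, 'm::{t2_space, second_countable_topology}, 'e::euclidean_space) atlas
     \<Rightarrow> ('i, 'e) tfield \<Rightarrow> bool" where
  "semi_riemannian A g \<longleftrightarrow>
     smooth_manifold A \<and> smooth_tfield A g \<and>
     (\<forall>i. \<forall>x\<in>chart_ran A i. \<forall>u v. g i x u v = g i x v u) \<and>
     (\<forall>i. \<forall>x\<in>chart_ran A i. \<forall>u. (\<forall>v. g i x u v = 0) \<longrightarrow> u = 0) \<and>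
     (\<exists>\<nu>. \<forall>i. \<forall>x\<in>chart_ran A i. form_index (g i x) = \<nu>)"

section \<open>Local differential geometry\<close>

text \<open>
  Here \<open>G\<close> is a metric, and \<open>X\<close>, \<open>Y\<close>, \<open>Z\<close> are vector fields, on an open subset of \<open>'e\<close>. A tangent
  vector \<open>w\<close> is extended to the constant vector field \<open>\<lambda>_. w\<close>; the expressions to which this is
  applied are tensorial in that argument, so the choice of extension is immaterial.
\<close>

definition lie_bracket ::
  "('e::euclidean_space \<Rightarrow> 'e) \<Rightarrow> ('e \<Rightarrow> 'e) \<Rightarrow> 'e \<Rightarrow> 'e" where
  "lie_bracket X Y x =
     frechet_derivative Y (at x) (X x) - frechet_derivative X (at x) (Y x)"

text \<open>\<open>(L\<^sub>X G)(Y, Z) = X(G(Y, Z)) - G([X, Y], Z) - G(Y, [X, Z])\<close>\<close>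

definition local_lie_derivative ::
  "('e::euclidean_space \<Rightarrow> 'e) \<Rightarrow> ('e \<Rightarrow> 'e \<Rightarrow> 'e \<Rightarrow> real) \<Rightarrow> 'e \<Rightarrow> 'e \<Rightarrow> 'e \<Rightarrow> real" where
  "local_lie_derivative X G x u v =
     frechet_derivative (\<lambda>y. G y u v) (at x) (X x)
     - G x (lie_bracket X (\<lambda>_. u) x) v - G x u (lie_bracket X (\<lambda>_. v) x)"

text \<open>The vector dual to a linear form with respect to a nondegenerate bilinear form.\<close>

definition sharp :: "('e \<Rightarrow> 'e \<Rightarrow> real) \<Rightarrow> ('e \<Rightarrow> real) \<Rightarrow> 'e" where
  "sharp B \<alpha> = (THE v. \<forall>w. B v w = \<alpha> w)"

text \<open>Levi-Civita connection \<open>\<nabla>\<^sub>X Y\<close>, by the Koszul formula.\<close>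

definition levi_civita ::
  "('e::euclidean_space \<Rightarrow> 'e \<Rightarrow> 'e \<Rightarrow> real) \<Rightarrow> ('e \<Rightarrow> 'e) \<Rightarrow> ('e \<Rightarrow> 'e) \<Rightarrow> 'e \<Rightarrow> 'e" where
  "levi_civita G X Y x = sharp (G x) (\<lambda>w.
     (frechet_derivative (\<lambda>y. G y (Y y) w) (at x) (X x)
      + frechet_derivative (\<lambda>y. G y w (X y)) (at x) (Y x)
      - frechet_derivative (\<lambda>y. G y (X y) (Y y)) (at x) w
      - G x (X x) (lie_bracket Y (\<lambda>_. w) x)
      + G x (Y x) (lie_bracket (\<lambda>_. w) X x)
      + G x w (lie_bracket X Y x)) / 2)"

definition curvature ::
  "('e::euclidean_space \<Rightarrow> 'e \<Rightarrow> 'e \<Rightarrow> real)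
     \<Rightarrow> ('e \<Rightarrow> 'e) \<Rightarrow> ('e \<Rightarrow> 'e) \<Rightarrow> ('e \<Rightarrow> 'e) \<Rightarrow> 'e \<Rightarrow> 'e" where
  "curvature G X Y Z x =
     levi_civita G X (levi_civita G Y Z) x - levi_civita G Y (levi_civita G X Z) x
     - levi_civita G (lie_bracket X Y) Z x"

definition trace_map :: "('e::euclidean_space \<Rightarrow> 'e) \<Rightarrow> real" where
  "trace_map L = (\<Sum>b\<in>Basis. L b \<bullet> b)"

definition local_ricci ::
  "('e::euclidean_space \<Rightarrow> 'e \<Rightarrow> 'e \<Rightarrow> real) \<Rightarrow> 'e \<Rightarrow> 'e \<Rightarrow> 'e \<Rightarrow> real" where
  "local_ricci G x v w = trace_map (\<lambda>u. curvature G (\<lambda>_. u) (\<lambda>_. v) (\<lambda>_. w) x)"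

definition local_scalar_curvature ::
  "('e::euclidean_space \<Rightarrow> 'e \<Rightarrow> 'e \<Rightarrow> real) \<Rightarrow> 'e \<Rightarrow> real" where
  "local_scalar_curvature G x = trace_map (\<lambda>u. sharp (G x) (local_ricci G x u))"

section \<open>Curvature, Killing fields, solitons, Einstein manifolds\<close>

definition lie_derivative ::
  "('i, 'e::euclidean_space) vfield \<Rightarrow> ('i, 'e) tfield \<Rightarrow> ('i, 'e) tfield" where
  "lie_derivative X g = (\<lambda>i. local_lie_derivative (X i) (g i))"

definition ricci :: "('i, 'e::euclidean_space) tfield \<Rightarrow> ('i, 'e) tfield" where
  "ricci g = (\<lambda>i. local_ricci (g i))"

text \<open>Computed in some chart around the point; for a metric it does not depend on the chart.\<close>

definition scalar_curvature ::
  "('i, 'm, 'e::euclidean_space) atlas \<Rightarrow> ('i, 'e) tfield \<Rightarrow> 'm \<Rightarrow> real" where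
  "scalar_curvature A g p =
     (let i = (SOME i. p \<in> chart_dom A i) in local_scalar_curvature (g i) (coord A i p))"

definition killing_field ::
  "('i, 'm, 'e::euclidean_space) atlas \<Rightarrow> ('i, 'e) tfield \<Rightarrow> ('i, 'e) vfield \<Rightarrow> bool" where
  "killing_field A g V \<longleftrightarrow> tensor_eq A (lie_derivative V g) (\<lambda>i x u v. 0)"

definition ricci_bourguignon_soliton ::
  "('i, 'm::{t2_space, second_countable_topology}, 'e::euclidean_space) atlas
     \<Rightarrow> ('i, 'e) tfield \<Rightarrow> ('i, 'e) vfield \<Rightarrow> real \<Rightarrow> real \<Rightarrow> bool" where
  "ricci_bourguignon_soliton A g X lam rho \<longleftrightarrow>
     semi_riemannian A g \<and> smooth_vfield A X \<and>
     tensor_eq A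
       (tensor_add (ricci g) (tensor_scale A (\<lambda>_. 1 / 2) (lie_derivative X g)))
       (tensor_add (tensor_scale A (\<lambda>_. lam) g)
         (tensor_scale A (\<lambda>p. rho * scalar_curvature A g p) g))"

definition einstein ::
  "('i, 'm::{t2_space, second_countable_topology}, 'e::euclidean_space) atlas
     \<Rightarrow> ('i, 'e) tfield \<Rightarrow> bool" where
  "einstein A g \<longleftrightarrow>
     semi_riemannian A g \<and>
     (\<exists>\<mu>. smooth_fun A \<mu> \<and> tensor_eq A (ricci g) (tensor_scale A \<mu> g))"

section \<open>Products, lifts and warped products\<close>

definition prod_atlas ::
  "('i, 'm, 'e) atlas \<Rightarrow> ('j, 'n, 'd) atlas \<Rightarrow> ('i \<times> 'j, 'm \<times> 'n, 'e \<times> 'd) atlas" where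
  "prod_atlas A B = (\<lambda>(i, j). (chart_dom A i \<times> chart_dom B j, map_prod (coord A i) (coord B j)))"

definition lift_vf_fst :: "('i, 'e) vfield \<Rightarrow> ('i \<times> 'j, 'e \<times> 'd::zero) vfield" where
  "lift_vf_fst X = (\<lambda>(i, j) (x, y). (X i x, 0))"

definition lift_vf_snd :: "('j, 'd) vfield \<Rightarrow> ('i \<times> 'j, 'e::zero \<times> 'd) vfield" where
  "lift_vf_snd Y = (\<lambda>(i, j) (x, y). (0, Y j y))"

definition lift_tensor_fst :: "('i, 'e) tfield \<Rightarrow> ('i \<times> 'j, 'e \<times> 'd) tfield" where
  "lift_tensor_fst S = (\<lambda>(i, j) (x, y) u v. S i x (fst u) (fst v))"

definition lift_tensor_snd :: "('j, 'd) tfield \<Rightarrow> ('i \<times> 'j, 'e \<times> 'd) tfield" where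
  "lift_tensor_snd T = (\<lambda>(i, j) (x, y) u v. T j y (snd u) (snd v))"

text \<open>The metric \<open>g \<oplus> f\<^sup>2 k\<close> of the warped product with base \<open>(A, g)\<close> and fibre \<open>(B, k)\<close>.\<close>

definition warped_metric ::
  "('i, 'm, 'e) atlas \<Rightarrow> ('i, 'e) tfield \<Rightarrow> ('m \<Rightarrow> real) \<Rightarrow> ('j, 'n, 'd) atlas \<Rightarrow> ('j, 'd) tfield
     \<Rightarrow> ('i \<times> 'j, 'e \<times> 'd) tfield" where
  "warped_metric A g f B k =
     tensor_add (lift_tensor_fst g)
       (tensor_scale (prod_atlas A B) (\<lambda>p. (f (fst p))\<^sup>2) (lift_tensor_snd k))"

definition seq_atlas ::
  "('i1, 'm1, 'e1) atlas \<Rightarrow> ('i2, 'm2, 'e2) atlas \<Rightarrow> ('i3, 'm3, 'e3) atlas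
     \<Rightarrow> (('i1 \<times> 'i2) \<times> 'i3, ('m1 \<times> 'm2) \<times> 'm3, ('e1 \<times> 'e2) \<times> 'e3) atlas" where
  "seq_atlas A1 A2 A3 = prod_atlas (prod_atlas A1 A2) A3"

definition seq_warped_metric ::
  "('i1, 'm1, 'e1) atlas \<Rightarrow> ('i1, 'e1) tfield \<Rightarrow> ('m1 \<Rightarrow> real)
     \<Rightarrow> ('i2, 'm2, 'e2) atlas \<Rightarrow> ('i2, 'e2) tfield \<Rightarrow> ('m1 \<times> 'm2 \<Rightarrow> real)
     \<Rightarrow> ('i3, 'm3, 'e3) atlas \<Rightarrow> ('i3, 'e3) tfield
     \<Rightarrow> (('i1 \<times> 'i2) \<times> 'i3, ('e1 \<times> 'e2) \<times> 'e3) tfield" where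
  "seq_warped_metric A1 g1 f A2 g2 h A3 g3 =
     warped_metric (prod_atlas A1 A2) (warped_metric A1 g1 f A2 g2) h A3 g3"

end

(* In each of the three cases L_X g = 0: on a warped product,
     L_{X+Y} (g + f^2 k) = L_X g + f^2 L_Y k + 2 f X(f) k,
   and applying this twice the hypotheses make the terms vanish or cancel. The soliton equation
   then reads Ric = mu g with mu = lam + rho R. The smoothness of mu is read off from this
   equation: in a chart, mu b is the solution v of G(v, w) = Ric(b, w) for a basis vector b, and
   solving linear equations with smooth nondegenerate coefficients preserves smoothness. *)
theory Submission
  imports Defs
begin

section \<open>Calculus of smooth maps\<close>

text \<open>Why smoothness of \<mu> takes work: \<open>scalar_curvature\<close> is evaluated at each
  point in a chart picked by \<open>SOME\<close>, so its local expression is not visibly smooth. The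
  relation Ric = \<mu> g, however, holds in every fixed chart, where the other two terms can be
  controlled. Controlling Ric is the same problem again: a covariant derivative is a
  \<open>sharp\<close>, that is, a \<open>THE\<close>, applied twice in the curvature, and all that
  is known about it is the linear equation it solves. Such equations are handled without a formula
  for the inverse. Around x0 the form is frozen at x0, and the unknown v then satisfies v = A - (sum
  of (v . c) H c) with H c vanishing at x0. The unknown occurs on both sides, but only multiplied by
  something small. A second obstacle is that fields agree only on chart ranges and
  \<open>vf_apply\<close> also picks its chart by \<open>SOME\<close>. The partial product of the
  first two factors therefore needs enough atlas structure to change charts, and this is derived
  from the factors.\<close>

lemma frechet_derivative_cong_open:
  assumes "open S" "x \<in> S" "\<And>y. y \<in> S \<Longrightarrow> f y = g y"
  shows "frechet_derivative f (at x) = frechet_derivative g (at x)"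
proof -
  have "(f has_derivative D) (at x) \<longleftrightarrow> (g has_derivative D) (at x)" for D
    using has_derivative_transform_within_open[of f D x UNIV S g]
      has_derivative_transform_within_open[of g D x UNIV S f] assms by auto
  then show ?thesis
    by (simp add: frechet_derivative_def)
qed

lemma frechet_derivative_eq: "(f has_derivative D) (at x) \<Longrightarrow> frechet_derivative f (at x) = D"
  using frechet_derivative_at by metis

lemma differentiable_cong_open:
  assumes "open S" "x \<in> S" "\<And>y. y \<in> S \<Longrightarrow> f y = g y" "f differentiable (at x)"
  shows "g differentiable (at x)"
  using assms has_derivative_transform_within_open unfolding differentiable_def by blast

lemma Ck_on_cong:
  assumes "open S" "\<And>y. y \<in> S \<Longrightarrow> f y = g y" "Ck_on k S f"
  shows "Ck_on k S g"
  using assms(2,3)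
proof (induction k arbitrary: f g)
  case 0
  then show ?case by (simp cong: continuous_on_cong)
next
  case (Suc k)
  have "g differentiable (at x)" if "x \<in> S" for x
    using differentiable_cong_open[OF assms(1) that Suc.prems(1)] Suc.prems(2) that by auto
  moreover have "Ck_on k S (\<lambda>x. frechet_derivative g (at x) v)" for v
    by (rule Suc.IH[of "\<lambda>x. frechet_derivative f (at x) v"])
      (use Suc.prems frechet_derivative_cong_open[OF assms(1) _ Suc.prems(1)] in auto)
  ultimately show ?case by simp
qed

text \<open>Derivatives at interior points are unique, so any explicitly given derivative may
  replace \<open>frechet_derivative\<close>. The closure rules below all feed a differentiation rule
  into this one and induct on k with the functions left general.\<close>

lemma Ck_on_SucI:
  assumes "open S" "\<And>x. x \<in> S \<Longrightarrow> (f has_derivative D x) (at x)"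
    and "\<And>v. Ck_on k S (\<lambda>x. D x v)"
  shows "Ck_on (Suc k) S f"
proof -
  have "Ck_on k S (\<lambda>x. frechet_derivative f (at x) v)" for v
    by (rule Ck_on_cong[OF assms(1) _ assms(3)[of v]]) (use frechet_derivative_eq assms(2) in metis)
  then show ?thesis using assms(2) by (auto simp: differentiable_def)
qed

lemma Ck_on_SucD: "Ck_on (Suc k) S f \<Longrightarrow> Ck_on k S f"
proof (induction k arbitrary: f)
  case 0
  then show ?case
    by (simp add: continuous_at_imp_continuous_on differentiable_imp_continuous_within)
next
  case (Suc k)
  then show ?case by (metis Ck_on.simps(2))
qed

lemma Ck_on_derivative:
  assumes "Ck_on (Suc k) S f" "x \<in> S"
  shows "(f has_derivative frechet_derivative f (at x)) (at x)"
  using assms by (simp add: frechet_derivative_works[symmetric])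

lemma Ck_on_const: "open S \<Longrightarrow> Ck_on k S (\<lambda>x. c)"
proof (induction k arbitrary: c)
  case (Suc k)
  show ?case
    by (rule Ck_on_SucI[OF Suc.prems has_derivative_const]) (use Suc in auto)
qed simp

lemma Ck_on_add:
  assumes "open S" "Ck_on k S f" "Ck_on k S g"
  shows "Ck_on k S (\<lambda>x. f x + g x)"
  using assms(2,3)
proof (induction k arbitrary: f g)
  case 0
  then show ?case by (simp add: continuous_on_add)
next
  case (Suc k)
  show ?case
    by (rule Ck_on_SucI[OF assms(1) has_derivative_add[OF Ck_on_derivative[OF Suc.prems(1)]
            Ck_on_derivative[OF Suc.prems(2)]]])
      (use Suc in auto)
qed

lemma (in bounded_linear) Ck_on:
  assumes "open S" "Ck_on k S g"
  shows "Ck_on k S (\<lambda>x. f (g x))"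
  using assms(2)
proof (induction k arbitrary: g)
  case 0
  then show ?case by (simp add: continuous_on)
next
  case (Suc k)
  show ?case
    by (rule Ck_on_SucI[OF assms(1) has_derivative[OF Ck_on_derivative[OF Suc.prems]]])
      (use Suc in auto)
qed

lemma (in bounded_bilinear) Ck_on:
  assumes "open S" "Ck_on k S f" "Ck_on k S g"
  shows "Ck_on k S (\<lambda>x. prod (f x) (g x))"
  using assms(2,3)
proof (induction k arbitrary: f g)
  case 0
  then show ?case by (simp add: continuous_on)
next
  case (Suc k)
  \<comment> \<open>The product rule brings back the undifferentiated factors, which are needed at
    level k as well.\<close>
  have "Ck_on k S f" "Ck_on k S g" using Suc.prems Ck_on_SucD by blast+
  then show ?case
    by (intro Ck_on_SucI[OF assms(1) FDERIV[OF Ck_on_derivative[OF Suc.prems(1)]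
            Ck_on_derivative[OF Suc.prems(2)]]] Ck_on_add[OF assms(1)] Suc.IH)
      (use Suc.prems in auto)
qed

lemmas Ck_on_scaleR = bounded_bilinear.Ck_on[OF bounded_bilinear_scaleR]
  and Ck_on_mult = bounded_bilinear.Ck_on[OF bounded_bilinear_mult]
  and Ck_on_inner_left = bounded_linear.Ck_on[OF bounded_linear_inner_left]
  and Ck_on_minus = bounded_linear.Ck_on[OF bounded_linear_minus[OF bounded_linear_ident]]

lemma Ck_on_diff:
  "open S \<Longrightarrow> Ck_on k S f \<Longrightarrow> Ck_on k S g \<Longrightarrow> Ck_on k S (\<lambda>x. f x - g x)"
  using Ck_on_add[of S k f "\<lambda>x. - g x"] Ck_on_minus[of S k g] by simp

lemma Ck_on_sum:
  "open S \<Longrightarrow> (\<And>i. i \<in> I \<Longrightarrow> Ck_on k S (f i)) \<Longrightarrow> Ck_on k S (\<lambda>x. \<Sum>i\<in>I. f i x)"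
  by (induction I rule: infinite_finite_induct) (auto intro!: Ck_on_const Ck_on_add)

lemma bilinear_sum_Basis:
  fixes B :: "'a::euclidean_space \<Rightarrow> 'b::real_vector \<Rightarrow> 'c::real_vector"
  assumes "bilinear B"
  shows "B u w = (\<Sum>b\<in>Basis. (u \<bullet> b) *\<^sub>R B b w)"
proof -
  interpret linear "\<lambda>u. B u w" using assms by (simp add: bilinear_def)
  have "B u w = B (\<Sum>b\<in>Basis. (u \<bullet> b) *\<^sub>R b) w" by (simp add: euclidean_representation)
  then show ?thesis by (simp add: sum scaleR)
qed

lemma linear_sum_Basis:
  fixes L :: "'a::euclidean_space \<Rightarrow> 'c::real_vector"
  assumes "linear L"
  shows "L u = (\<Sum>b\<in>Basis. (u \<bullet> b) *\<^sub>R L b)"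
proof -
  interpret linear L by fact
  have "L u = L (\<Sum>b\<in>Basis. (u \<bullet> b) *\<^sub>R b)" by (simp add: euclidean_representation)
  then show ?thesis by (simp add: sum scaleR)
qed

section \<open>Linear equations with smooth coefficients\<close>

text \<open>A product rule with a merely continuous factor q: the term in which q would be
  differentiated is multiplied by H x0 = 0. The remainder splits as q x times the remainder of H,
  plus (q x - q x0) H'(x - x0), and both are o(x - x0).\<close>

lemma has_derivative_scaleR_zero:
  fixes q :: "'a::real_normed_vector \<Rightarrow> real" and H :: "'a \<Rightarrow> 'b::real_normed_vector"
  assumes q: "isCont q x0" and H: "(H has_derivative H') (at x0)" and H0: "H x0 = 0"
  shows "((\<lambda>x. q x *\<^sub>R H x) has_derivative (\<lambda>e. q x0 *\<^sub>R H' e)) (at x0)"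
proof -
  interpret bounded_linear H' using H by (rule has_derivative_bounded_linear)
  obtain K where K: "K > 0" "\<And>e. norm (H' e) \<le> norm e * K" using pos_bounded by blast
  have lim: "((\<lambda>x. norm (H x - H x0 - H' (x - x0)) / norm (x - x0)) \<longlongrightarrow> 0) (at x0)"
    using H by (simp add: has_derivative_iff_norm)
  have q': "(q \<longlongrightarrow> q x0) (at x0)" using q by (simp add: isCont_def)
  have "((\<lambda>x. \<bar>q x\<bar> * (norm (H x - H x0 - H' (x - x0)) / norm (x - x0)) + \<bar>q x - q x0\<bar> * K)
      \<longlongrightarrow> \<bar>q x0\<bar> * 0 + \<bar>q x0 - q x0\<bar> * K) (at x0)"
    by (intro tendsto_intros q' lim)
  then have lim2: "((\<lambda>x. \<bar>q x\<bar> * (norm (H x - H x0 - H' (x - x0)) / norm (x - x0)) + \<bar>q x - q x0\<bar> * K)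
      \<longlongrightarrow> 0) (at x0)"
    by simp
  have "((\<lambda>x. norm (q x *\<^sub>R H x - q x0 *\<^sub>R H x0 - q x0 *\<^sub>R H' (x - x0)) / norm (x - x0)) \<longlongrightarrow> 0) (at x0)"
  proof (rule Lim_null_comparison[OF _ lim2], rule always_eventually, rule allI)
    fix x
    have "q x *\<^sub>R H x - q x0 *\<^sub>R H x0 - q x0 *\<^sub>R H' (x - x0) =
        q x *\<^sub>R (H x - H x0 - H' (x - x0)) + (q x - q x0) *\<^sub>R H' (x - x0)"
      by (simp add: H0 algebra_simps)
    then have "norm (q x *\<^sub>R H x - q x0 *\<^sub>R H x0 - q x0 *\<^sub>R H' (x - x0)) \<le>
        \<bar>q x\<bar> * norm (H x - H x0 - H' (x - x0)) + \<bar>q x - q x0\<bar> * norm (H' (x - x0))"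
      by (metis norm_scaleR norm_triangle_ineq)
    also have "\<dots> \<le> \<bar>q x\<bar> * norm (H x - H x0 - H' (x - x0)) + \<bar>q x - q x0\<bar> * (norm (x - x0) * K)"
      by (intro add_left_mono mult_left_mono K) auto
    \<comment> \<open>The bound is claimed at every x; at x = x0 both sides are 0, since division by
      zero gives 0.\<close>
    finally show "norm (norm (q x *\<^sub>R H x - q x0 *\<^sub>R H x0 - q x0 *\<^sub>R H' (x - x0)) / norm (x - x0))
       \<le> \<bar>q x\<bar> * (norm (H x - H x0 - H' (x - x0)) / norm (x - x0)) + \<bar>q x - q x0\<bar> * K"
      by (cases "x = x0") (simp_all add: divide_simps algebra_simps)
  qed
  moreover have "bounded_linear (\<lambda>e. q x0 *\<^sub>R H' e)"
    using bounded_linear_axioms by (rule bounded_linear_const_scaleR)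
  ultimately show ?thesis by (simp add: has_derivative_iff_norm)
qed

text \<open>An absorption argument: v - A is bounded by norm (v x) times N, the sum of the norms of
  the H c, and N tends to 0. What must be excluded is that v itself is unbounded near x0.\<close>

lemma isCont_implicit_linear:
  fixes v A :: "'a::real_normed_vector \<Rightarrow> 'e::euclidean_space" and H :: "'e \<Rightarrow> 'a \<Rightarrow> 'e"
  assumes S: "open S" "x0 \<in> S"
    and eq: "\<And>x. x \<in> S \<Longrightarrow> v x = A x - (\<Sum>c\<in>Basis. (v x \<bullet> c) *\<^sub>R H c x)"
    and A: "isCont A x0" and H: "\<And>c. c \<in> Basis \<Longrightarrow> isCont (H c) x0"
    and H0: "\<And>c. c \<in> Basis \<Longrightarrow> H c x0 = 0"
  shows "isCont v x0"
proof -
  have v0: "v x0 = A x0" using eq[OF S(2)] H0 by simp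
  let ?N = "\<lambda>x. \<Sum>c\<in>Basis. norm (H c x)"
  have "(?N \<longlongrightarrow> (\<Sum>c\<in>(Basis::'e set). norm (0::'e))) (at x0)"
    using H H0 by (intro tendsto_sum tendsto_norm) (metis isCont_def)
  then have N: "(?N \<longlongrightarrow> 0) (at x0)" by simp
  have A': "(A \<longlongrightarrow> A x0) (at x0)" using A by (simp add: isCont_def)
  have bd: "norm (v x - A x) \<le> norm (v x) * ?N x" if "x \<in> S" for x
  proof -
    have "norm (v x - A x) = norm (\<Sum>c\<in>Basis. (v x \<bullet> c) *\<^sub>R H c x)"
      by (subst eq[OF that]) simp
    also have "\<dots> \<le> (\<Sum>c\<in>Basis. norm (v x) * norm (H c x))"
      by (intro sum_norm_le) (simp add: Basis_le_norm mult_right_mono)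
    finally show ?thesis by (simp add: sum_distrib_left)
  qed
  have ev: "\<forall>\<^sub>F x in at x0. x \<in> S" using S by (simp add: eventually_at_topological) blast
  \<comment> \<open>With N below 1/2, half of norm (v x) is absorbed on the left, so norm (v x) is
    at most 2 norm (A x). The error bound then no longer contains v.\<close>
  have "\<forall>\<^sub>F x in at x0. ?N x < 1/2" using N by (rule order_tendstoD) simp
  then have "\<forall>\<^sub>F x in at x0. norm (v x - A x) \<le> 2 * norm (A x) * ?N x"
    using ev
  proof eventually_elim
    case (elim x)
    have "norm (v x) * ?N x \<le> norm (v x) * (1/2)" using elim by (intro mult_left_mono) auto
    then have "norm (v x) \<le> 2 * norm (A x)"
      using bd[OF elim(2)] norm_triangle_sub[of "v x" "A x"] by simp
    then have "norm (v x) * ?N x \<le> 2 * norm (A x) * ?N x"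
      by (intro mult_right_mono sum_nonneg) auto
    then show ?case using bd[OF elim(2)] by simp
  qed
  moreover have "((\<lambda>x. 2 * norm (A x) * ?N x) \<longlongrightarrow> 2 * norm (A x0) * 0) (at x0)"
    by (intro tendsto_intros A' N)
  then have "((\<lambda>x. 2 * norm (A x) * ?N x) \<longlongrightarrow> 0) (at x0)" by simp
  ultimately have "((\<lambda>x. v x - A x) \<longlongrightarrow> 0) (at x0)"
    by (rule Lim_null_comparison)
  from tendsto_add[OF this A'] show ?thesis by (simp add: isCont_def v0)
qed

text \<open>There is no circularity in differentiating the right-hand side: its coefficients v x . c
  are already known to be continuous, and that suffices because they multiply functions vanishing at
  x0.\<close>

lemma differentiable_implicit_linear:
  fixes v A :: "'a::real_normed_vector \<Rightarrow> 'e::euclidean_space" and H :: "'e \<Rightarrow> 'a \<Rightarrow> 'e"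
  assumes S: "open S" "x0 \<in> S"
    and eq: "\<And>x. x \<in> S \<Longrightarrow> v x = A x - (\<Sum>c\<in>Basis. (v x \<bullet> c) *\<^sub>R H c x)"
    and A: "A differentiable (at x0)" and H: "\<And>c. c \<in> Basis \<Longrightarrow> H c differentiable (at x0)"
    and H0: "\<And>c. c \<in> Basis \<Longrightarrow> H c x0 = 0"
  shows "v differentiable (at x0)"
proof -
  have "isCont v x0"
  proof (rule isCont_implicit_linear[OF S])
    show "v x = A x - (\<Sum>c\<in>Basis. (v x \<bullet> c) *\<^sub>R H c x)" if "x \<in> S" for x
      using eq[OF that] .
  qed (use H0 in \<open>auto intro!: differentiable_imp_continuous_within A H\<close>)
  then have "isCont (\<lambda>x. v x \<bullet> c) x0" for c by simp
  then have "(\<lambda>x. (v x \<bullet> c) *\<^sub>R H c x) differentiable (at x0)" if "c \<in> Basis" for c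
    using has_derivative_scaleR_zero[where q = "\<lambda>x. v x \<bullet> c" and ?x0.0 = x0 and H = "H c"]
      H[OF that] H0[OF that]
    unfolding differentiable_def by blast
  then have "(\<lambda>x. A x - (\<Sum>c\<in>Basis. (v x \<bullet> c) *\<^sub>R H c x)) differentiable (at x0)"
    using A by (intro differentiable_diff differentiable_sum) auto
  then show ?thesis
    by (rule differentiable_cong_open[OF S, rotated]) (use eq in metis)
qed

definition nondegenerate :: "('e::real_vector \<Rightarrow> 'e \<Rightarrow> real) \<Rightarrow> bool" where
  "nondegenerate B \<longleftrightarrow> bilinear B \<and> (\<forall>u. (\<forall>w. B u w = 0) \<longrightarrow> u = 0)"

text \<open>The map encodes the functional B u as the vector of its values on the basis, so its
  kernel is the radical of B. In finite dimension injectivity gives both surjectivity, used for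
  \<open>sharp\<close>, and a linear left inverse, used to solve equations.\<close>

lemma nondegenerate_inj:
  assumes "nondegenerate (B :: 'e::euclidean_space \<Rightarrow> 'e \<Rightarrow> real)"
  shows "linear (\<lambda>u. \<Sum>b\<in>Basis. B u b *\<^sub>R b)" "inj (\<lambda>u. \<Sum>b\<in>Basis. B u b *\<^sub>R b)"
proof -
  have bl: "bilinear B" using assms by (simp add: nondegenerate_def)
  have l: "linear (\<lambda>u. B u w)" for w using bl by (simp add: bilinear_def)
  have lin2: "linear (B u)" for u using bl by (simp add: bilinear_def)
  show L: "linear (\<lambda>u. \<Sum>b\<in>Basis. B u b *\<^sub>R b)"
    by (rule linearI) (simp_all add: linear_add[OF l] linear_scale[OF l] scaleR_left_distrib
        sum.distrib scaleR_right.sum)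
  have "u = 0" if "(\<Sum>b\<in>Basis. B u b *\<^sub>R b) = 0" for u
  proof -
    have "B u b = 0" if "b \<in> Basis" for b
      using arg_cong[OF \<open>(\<Sum>b\<in>Basis. B u b *\<^sub>R b) = 0\<close>, of "\<lambda>z. z \<bullet> b"] that
      by (simp add: inner_sum_left_Basis)
    then have "B u w = 0" for w
      using linear_sum_Basis[OF lin2[of u], of w] by simp
    then show ?thesis using assms by (auto simp: nondegenerate_def)
  qed
  then show "inj (\<lambda>u. \<Sum>b\<in>Basis. B u b *\<^sub>R b)"
    using L by (simp add: linear_injective_0)
qed

lemma sharp_works:
  assumes "nondegenerate (B :: 'e::euclidean_space \<Rightarrow> 'e \<Rightarrow> real)" "linear \<alpha>"
  shows "B (sharp B \<alpha>) w = \<alpha> w"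
proof -
  have bl: "bilinear B" using assms by (simp add: nondegenerate_def)
  obtain u where u: "(\<Sum>b\<in>Basis. B u b *\<^sub>R b) = (\<Sum>b\<in>Basis. \<alpha> b *\<^sub>R b)"
    using surjD[OF linear_injective_imp_surjective[OF nondegenerate_inj[OF assms(1)]],
        of "\<Sum>b\<in>Basis. \<alpha> b *\<^sub>R b"] by auto
  have ub: "B u b = \<alpha> b" if "b \<in> Basis" for b
    using arg_cong[OF u, of "\<lambda>z. z \<bullet> b"] that by (simp add: inner_sum_left_Basis)
  have "linear (B u)" using bl by (simp add: bilinear_def)
  from linear_eq_stdbasis[OF this assms(2)] ub have ex: "\<forall>w. B u w = \<alpha> w" by metis
  have uniq: "v = u" if "\<forall>w. B v w = \<alpha> w" for v
  proof -
    have "B (v - u) w = 0" for w using that ex by (simp add: bilinear_lsub[OF bl])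
    then have "v - u = 0" using assms(1) unfolding nondegenerate_def by blast
    then show ?thesis by simp
  qed
  have "sharp B \<alpha> = u" unfolding sharp_def by (rule the_equality) (fact ex, rule uniq)
  then show ?thesis using ex by simp
qed

text \<open>Differentiating \<open>G x (v x) w = \<alpha> x w\<close> shows that the derivatives of \<open>v\<close> solve an equation of the
  same form, which drives the induction on \<open>k\<close>.\<close>

lemma Ck_on_solution:
  fixes G :: "'a::euclidean_space \<Rightarrow> 'e::euclidean_space \<Rightarrow> 'e \<Rightarrow> real"
  assumes S: "open S" and G: "\<And>x. x \<in> S \<Longrightarrow> nondegenerate (G x)"
    and smooth: "\<And>u w. smooth_on S (\<lambda>x. G x u w)"
    and "\<And>x w. x \<in> S \<Longrightarrow> G x (v x) w = \<alpha> x w" "\<And>w. Ck_on k S (\<lambda>x. \<alpha> x w)"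
  shows "Ck_on k S v"
proof -
  have bl: "bilinear (G x)" if "x \<in> S" for x using G[OF that] by (simp add: nondegenerate_def)
  have GC: "Ck_on m S (\<lambda>x. G x u w)" for m u w using smooth by (simp add: smooth_on_def)
  \<comment> \<open>C inverts the form frozen at x0. Replacing G x by G x0 in the equation costs the
    differences G x c b - G x0 c b, which vanish at x0. Solution and right-hand side are kept
    general because the induction applies this to the derivatives of v too.\<close>
  have implicit: "\<exists>C. linear C \<and> (\<forall>x\<in>S. v x = (\<Sum>b\<in>Basis. \<alpha> x b *\<^sub>R C b) -
      (\<Sum>c\<in>Basis. (v x \<bullet> c) *\<^sub>R (\<Sum>b\<in>Basis. (G x c b - G x0 c b) *\<^sub>R C b)))"
    if x0: "x0 \<in> S" and v: "\<And>x w. x \<in> S \<Longrightarrow> G x (v x) w = \<alpha> x w" for x0 v \<alpha>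
  proof -
    let ?B = "\<lambda>u. \<Sum>b\<in>Basis. G x0 u b *\<^sub>R b"
    obtain C where C: "linear C" "C \<circ> ?B = id"
      using linear_injective_left_inverse[OF nondegenerate_inj[OF G[OF x0]]] by blast
    have "v x = (\<Sum>b\<in>Basis. \<alpha> x b *\<^sub>R C b) -
      (\<Sum>c\<in>Basis. (v x \<bullet> c) *\<^sub>R (\<Sum>b\<in>Basis. (G x c b - G x0 c b) *\<^sub>R C b))" if x: "x \<in> S" for x
    proof -
      have g0: "G x0 (v x) b = \<alpha> x b - (\<Sum>c\<in>Basis. (v x \<bullet> c) * (G x c b - G x0 c b))" for b
        using bilinear_sum_Basis[OF bl[OF x], of "v x" b] bilinear_sum_Basis[OF bl[OF x0], of "v x" b]
          v[OF x, of b] by (simp add: right_diff_distrib sum_subtractf)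
      have "v x = C (?B (v x))" using fun_cong[OF C(2), of "v x"] by simp
      also have "\<dots> = (\<Sum>b\<in>Basis. G x0 (v x) b *\<^sub>R C b)"
        by (simp add: linear_sum[OF C(1)] linear_scale[OF C(1)])
      also have "\<dots> = (\<Sum>b\<in>Basis. \<alpha> x b *\<^sub>R C b) -
          (\<Sum>b\<in>Basis. \<Sum>c\<in>Basis. ((v x \<bullet> c) * (G x c b - G x0 c b)) *\<^sub>R C b)"
        by (simp only: g0 scaleR_left_diff_distrib sum_subtractf scaleR_left.sum)
      also have "(\<Sum>b\<in>Basis. \<Sum>c\<in>Basis. ((v x \<bullet> c) * (G x c b - G x0 c b)) *\<^sub>R C b) =
          (\<Sum>c\<in>Basis. (v x \<bullet> c) *\<^sub>R (\<Sum>b\<in>Basis. (G x c b - G x0 c b) *\<^sub>R C b))"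
        by (subst sum.swap) (simp add: scaleR_right.sum)
      finally show ?thesis .
    qed
    then show ?thesis using C(1) by blast
  qed
  from assms(4,5) show ?thesis
  proof (induction k arbitrary: v \<alpha>)
    case 0
    have "isCont v x0" if x0: "x0 \<in> S" for x0
    proof -
      obtain C where C: "\<forall>x\<in>S. v x = (\<Sum>b\<in>Basis. \<alpha> x b *\<^sub>R C b) -
        (\<Sum>c\<in>Basis. (v x \<bullet> c) *\<^sub>R (\<Sum>b\<in>Basis. (G x c b - G x0 c b) *\<^sub>R C b))"
        using implicit[OF x0 0(1)] by blast
      show ?thesis
      proof (rule isCont_implicit_linear[OF S x0])
        show "isCont (\<lambda>x. \<Sum>b\<in>Basis. \<alpha> x b *\<^sub>R C b) x0"
          using 0(2) S x0 by (intro continuous_intros) (simp add: continuous_on_eq_continuous_at)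
        show "isCont (\<lambda>x. \<Sum>b\<in>Basis. (G x c b - G x0 c b) *\<^sub>R C b) x0" for c
          using GC[of 0] S x0 by (intro continuous_intros) (simp add: continuous_on_eq_continuous_at)
      qed (use C in auto)
    qed
    then show ?case by (simp add: continuous_at_imp_continuous_on)
  next
    case (Suc k)
    \<comment> \<open>Regularity of v itself at level k comes first, since v reappears
      undifferentiated in the equation for its derivative.\<close>
    have vk: "Ck_on k S v" using Suc.IH[OF Suc.prems(1)] Suc.prems(2) Ck_on_SucD by blast
    have diff: "v differentiable (at x0)" if x0: "x0 \<in> S" for x0
    proof -
      obtain C where C: "\<forall>x\<in>S. v x = (\<Sum>b\<in>Basis. \<alpha> x b *\<^sub>R C b) -
        (\<Sum>c\<in>Basis. (v x \<bullet> c) *\<^sub>R (\<Sum>b\<in>Basis. (G x c b - G x0 c b) *\<^sub>R C b))"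
        using implicit[OF x0 Suc.prems(1)] by blast
      show ?thesis
      proof (rule differentiable_implicit_linear[OF S x0])
        show "(\<lambda>x. \<Sum>b\<in>Basis. \<alpha> x b *\<^sub>R C b) differentiable (at x0)"
          using Suc.prems(2) x0 by (intro differentiable_sum differentiable_scaleR) auto
        show "(\<lambda>x. \<Sum>b\<in>Basis. (G x c b - G x0 c b) *\<^sub>R C b) differentiable (at x0)" for c
          using GC[of "Suc 0"] x0
          by (intro differentiable_sum differentiable_scaleR differentiable_diff) auto
      qed (use C in auto)
    qed
    have "Ck_on k S (\<lambda>x. frechet_derivative v (at x) e)" for e
    proof (rule Suc.IH)
      \<comment> \<open>Differentiate the sum of (v . c) G c w, which equals \<alpha> w, in the
        direction e. The terms that differentiate v add up to G x (Dv e) w; the others are moved to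
        the right.\<close>
      let ?\<alpha>' = "\<lambda>x w. frechet_derivative (\<lambda>y. \<alpha> y w) (at x) e -
          (\<Sum>c\<in>Basis. (v x \<bullet> c) * frechet_derivative (\<lambda>y. G y c w) (at x) e)"
      show "Ck_on k S (\<lambda>x. ?\<alpha>' x w)" for w
        using Suc.prems(2) GC[of "Suc k"] vk
        by (intro Ck_on_diff Ck_on_sum Ck_on_mult Ck_on_inner_left S) auto
      show "G x (frechet_derivative v (at x) e) w = ?\<alpha>' x w" if x: "x \<in> S" for x w
      proof -
        have dv: "(v has_derivative frechet_derivative v (at x)) (at x)"
          using diff[OF x] by (simp add: frechet_derivative_works[symmetric])
        have dG: "((\<lambda>y. G y c w) has_derivative frechet_derivative (\<lambda>y. G y c w) (at x)) (at x)" for c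
          using GC x by (rule Ck_on_derivative)
        have "((\<lambda>y. \<Sum>c\<in>Basis. (v y \<bullet> c) * G y c w) has_derivative
          (\<lambda>e. \<Sum>c\<in>Basis. (v x \<bullet> c) * frechet_derivative (\<lambda>y. G y c w) (at x) e +
             (frechet_derivative v (at x) e \<bullet> c) * G x c w)) (at x)"
          by (intro has_derivative_sum has_derivative_mult has_derivative_inner_left dv dG)
        moreover have "(\<Sum>c\<in>Basis. (v y \<bullet> c) * G y c w) = \<alpha> y w" if "y \<in> S" for y
          using bilinear_sum_Basis[OF bl[OF that], of "v y" w] Suc.prems(1)[OF that] by simp
        ultimately have "((\<lambda>y. \<alpha> y w) has_derivative
          (\<lambda>e. \<Sum>c\<in>Basis. (v x \<bullet> c) * frechet_derivative (\<lambda>y. G y c w) (at x) e +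
             (frechet_derivative v (at x) e \<bullet> c) * G x c w)) (at x)"
          by (rule has_derivative_transform_within_open[OF _ S x])
        then have "frechet_derivative (\<lambda>y. \<alpha> y w) (at x) e =
          (\<Sum>c\<in>Basis. (v x \<bullet> c) * frechet_derivative (\<lambda>y. G y c w) (at x) e +
             (frechet_derivative v (at x) e \<bullet> c) * G x c w)"
          by (simp add: frechet_derivative_eq)
        then show ?thesis
          using bilinear_sum_Basis[OF bl[OF x], of "frechet_derivative v (at x) e" w]
          by (simp add: sum.distrib)
      qed
    qed
    then show ?case using diff by simp
  qed
qed

section \<open>Smooth maps: closure rules and derivatives along fields\<close>

lemma smooth_on_cong:
  "open S \<Longrightarrow> (\<And>y. y \<in> S \<Longrightarrow> f y = g y) \<Longrightarrow> smooth_on S f \<Longrightarrow> smooth_on S g"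
  unfolding smooth_on_def using Ck_on_cong by metis

lemma smooth_on_const: "open S \<Longrightarrow> smooth_on S (\<lambda>x. c)"
  by (simp add: smooth_on_def Ck_on_const)

lemma smooth_on_add:
  "open S \<Longrightarrow> smooth_on S f \<Longrightarrow> smooth_on S g \<Longrightarrow> smooth_on S (\<lambda>x. f x + g x)"
  by (simp add: smooth_on_def Ck_on_add)

lemma smooth_on_minus: "open S \<Longrightarrow> smooth_on S f \<Longrightarrow> smooth_on S (\<lambda>x. - f x)"
  by (simp add: smooth_on_def Ck_on_minus)

lemma smooth_on_diff:
  "open S \<Longrightarrow> smooth_on S f \<Longrightarrow> smooth_on S g \<Longrightarrow> smooth_on S (\<lambda>x. f x - g x)"
  by (simp add: smooth_on_def Ck_on_diff)

lemma smooth_on_sum: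
  "open S \<Longrightarrow> (\<And>i. i \<in> I \<Longrightarrow> smooth_on S (f i)) \<Longrightarrow> smooth_on S (\<lambda>x. \<Sum>i\<in>I. f i x)"
  by (simp add: smooth_on_def Ck_on_sum)

lemma smooth_on_scaleR:
  "open S \<Longrightarrow> smooth_on S f \<Longrightarrow> smooth_on S g \<Longrightarrow> smooth_on S (\<lambda>x. f x *\<^sub>R g x)"
  by (simp add: smooth_on_def Ck_on_scaleR)

lemma smooth_on_inner_left: "open S \<Longrightarrow> smooth_on S f \<Longrightarrow> smooth_on S (\<lambda>x. f x \<bullet> c)"
  by (simp add: smooth_on_def Ck_on_inner_left)

lemma smooth_on_frechet_derivative:
  "smooth_on S f \<Longrightarrow> smooth_on S (\<lambda>x. frechet_derivative f (at x) v)"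
  unfolding smooth_on_def using Ck_on.simps(2) by blast

lemma smooth_on_differentiable: "smooth_on S f \<Longrightarrow> x \<in> S \<Longrightarrow> f differentiable (at x)"
  unfolding smooth_on_def using Ck_on.simps(2) by blast

text \<open>\<open>Ck_on\<close> controls derivatives in fixed directions only, so the varying
  direction X x is expanded in the basis.\<close>

lemma smooth_on_directional_derivative:
  assumes S: "open S" and f: "smooth_on S f" and X: "smooth_on S X"
  shows "smooth_on S (\<lambda>x. frechet_derivative f (at x) (X x))"
proof (rule smooth_on_cong[OF S])
  show "smooth_on S (\<lambda>x. \<Sum>b\<in>Basis. (X x \<bullet> b) *\<^sub>R frechet_derivative f (at x) b)"
    by (intro smooth_on_sum smooth_on_scaleR smooth_on_inner_left smooth_on_frechet_derivative S f X)
  show "(\<Sum>b\<in>Basis. (X x \<bullet> b) *\<^sub>R frechet_derivative f (at x) b) = frechet_derivative f (at x) (X x)"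
    if "x \<in> S" for x
    by (rule linear_sum_Basis[symmetric] linear_frechet_derivative smooth_on_differentiable[OF f that])+
qed

section \<open>Smoothness of the curvature\<close>

definition smooth_form_on :: "'e::euclidean_space set \<Rightarrow> ('e \<Rightarrow> 'e \<Rightarrow> 'e \<Rightarrow> real) \<Rightarrow> bool" where
  "smooth_form_on S G \<longleftrightarrow>
     (\<forall>x\<in>S. nondegenerate (G x)) \<and> (\<forall>u w. smooth_on S (\<lambda>x. G x u w))"

lemma smooth_form_on_linear:
  assumes "smooth_form_on S G" "x \<in> S"
  shows "linear (\<lambda>u. G x u w)" "linear (G x u)"
  using assms by (auto simp: smooth_form_on_def nondegenerate_def bilinear_def)

lemma smooth_on_form:
  assumes S: "open S" and G: "smooth_form_on S G" and X: "smooth_on S X" and Y: "smooth_on S Y"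
  shows "smooth_on S (\<lambda>x. G x (X x) (Y x))"
proof (rule smooth_on_cong[OF S])
  show "smooth_on S (\<lambda>x. \<Sum>b\<in>Basis. (X x \<bullet> b) *\<^sub>R (\<Sum>c\<in>Basis. (Y x \<bullet> c) *\<^sub>R G x b c))"
    using G unfolding smooth_form_on_def
    by (intro smooth_on_sum smooth_on_scaleR smooth_on_inner_left S X Y) auto
  fix x assume x: "x \<in> S"
  show "(\<Sum>b\<in>Basis. (X x \<bullet> b) *\<^sub>R (\<Sum>c\<in>Basis. (Y x \<bullet> c) *\<^sub>R G x b c)) = G x (X x) (Y x)"
    by (simp only: linear_sum_Basis[OF smooth_form_on_linear(1)[OF G x], of "X x" "Y x"]
        linear_sum_Basis[OF smooth_form_on_linear(2)[OF G x], symmetric])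
qed

text \<open>Serves the Koszul formula, whose first two terms contain the test vector w inside a
  differentiated function. Linearity in w is available only for base points in S, hence the local
  congruence of derivatives.\<close>

lemma linear_derivative_of_linear:
  assumes S: "open S" "x \<in> S" and "\<And>y. y \<in> S \<Longrightarrow> linear (L y)"
    and d: "\<And>w. (\<lambda>y. L y w) differentiable (at x)"
  shows "linear (\<lambda>w. frechet_derivative (\<lambda>y. L y w) (at x) e)"
proof (rule linearI)
  have D: "((\<lambda>y. L y w) has_derivative frechet_derivative (\<lambda>y. L y w) (at x)) (at x)" for w
    using d by (simp add: frechet_derivative_works[symmetric])
  fix u w and r :: real
  have "frechet_derivative (\<lambda>y. L y (u + w)) (at x) = frechet_derivative (\<lambda>y. L y u + L y w) (at x)"
    by (rule frechet_derivative_cong_open[OF S]) (simp add: assms(3) linear_add)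
  then show "frechet_derivative (\<lambda>y. L y (u + w)) (at x) e =
      frechet_derivative (\<lambda>y. L y u) (at x) e + frechet_derivative (\<lambda>y. L y w) (at x) e"
    by (simp add: frechet_derivative_eq[OF has_derivative_add[OF D D]])
  have "frechet_derivative (\<lambda>y. L y (r *\<^sub>R u)) (at x) = frechet_derivative (\<lambda>y. r *\<^sub>R L y u) (at x)"
    by (rule frechet_derivative_cong_open[OF S]) (simp add: assms(3) linear_scale)
  then show "frechet_derivative (\<lambda>y. L y (r *\<^sub>R u)) (at x) e =
      r *\<^sub>R frechet_derivative (\<lambda>y. L y u) (at x) e"
    by (simp add: frechet_derivative_eq[OF has_derivative_scaleR_right[OF D]])
qed

lemma lie_bracket_const_right: "lie_bracket X (\<lambda>_. u) x = - frechet_derivative X (at x) u"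
  by (simp add: lie_bracket_def)

lemma lie_bracket_const_left: "lie_bracket (\<lambda>_. u) X x = frechet_derivative X (at x) u"
  by (simp add: lie_bracket_def)

text \<open>The \<open>sharp\<close> in the connection is replaced by its defining equation G x
  (levi_civita G X Y x) w = \<alpha> x w, with \<alpha> the Koszul expression;
  \<open>Ck_on_solution\<close> then gives smoothness.\<close>

lemma smooth_on_levi_civita:
  assumes S: "open S" and G: "smooth_form_on S G" and X: "smooth_on S X" and Y: "smooth_on S Y"
  shows "smooth_on S (levi_civita G X Y)"
proof -
  define \<alpha> where "\<alpha> x w = (frechet_derivative (\<lambda>y. G y (Y y) w) (at x) (X x)
      + frechet_derivative (\<lambda>y. G y w (X y)) (at x) (Y x)
      - frechet_derivative (\<lambda>y. G y (X y) (Y y)) (at x) w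
      - G x (X x) (lie_bracket Y (\<lambda>_. w) x)
      + G x (Y x) (lie_bracket (\<lambda>_. w) X x)
      + G x w (lie_bracket X Y x)) / 2" for x w
  note intros = S X Y smooth_on_form[OF S G] smooth_on_directional_derivative[OF S]
    smooth_on_frechet_derivative smooth_on_const smooth_on_add smooth_on_diff smooth_on_minus
  have "smooth_on S (lie_bracket X Y)"
    unfolding lie_bracket_def[abs_def] by (intro intros)
  then have "smooth_on S (\<lambda>x. (1 / 2) *\<^sub>R (frechet_derivative (\<lambda>y. G y (Y y) w) (at x) (X x)
      + frechet_derivative (\<lambda>y. G y w (X y)) (at x) (Y x)
      - frechet_derivative (\<lambda>y. G y (X y) (Y y)) (at x) w
      - G x (X x) (lie_bracket Y (\<lambda>_. w) x)
      + G x (Y x) (lie_bracket (\<lambda>_. w) X x)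
      + G x w (lie_bracket X Y x)))" for w
    unfolding lie_bracket_const_left lie_bracket_const_right
    by (intro smooth_on_scaleR intros)
  then have smooth: "smooth_on S (\<lambda>x. \<alpha> x w)" for w
    by (simp add: \<alpha>_def)
  \<comment> \<open>Only a linear functional is represented by a vector, so this is what makes the
    description by \<open>THE\<close> meaningful.\<close>
  have lin: "linear (\<alpha> x)" if x: "x \<in> S" for x
  proof -
    have diff: "(\<lambda>y. G y (P y) (Q y)) differentiable (at x)"
      if "smooth_on S P" "smooth_on S Q" for P Q
      using smooth_on_form[OF S G that] x by (rule smooth_on_differentiable)
    note l1 = smooth_form_on_linear(1)[OF G] and l2 = smooth_form_on_linear(2)[OF G]
    have "linear (\<lambda>w. frechet_derivative (\<lambda>y. G y (Y y) w) (at x) (X x))"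
      by (rule linear_derivative_of_linear[OF S x]) (intro l2 diff Y smooth_on_const S | assumption)+
    moreover have "linear (\<lambda>w. frechet_derivative (\<lambda>y. G y w (X y)) (at x) (Y x))"
      by (rule linear_derivative_of_linear[OF S x]) (intro l1 diff X smooth_on_const S | assumption)+
    moreover have "linear (frechet_derivative (\<lambda>y. G y (X y) (Y y)) (at x))"
      by (intro linear_frechet_derivative diff X Y)
    moreover have "linear (\<lambda>w. G x (X x) (lie_bracket Y (\<lambda>_. w) x))"
      unfolding lie_bracket_const_right
      by (intro linear_compose[OF _ l2[OF x], unfolded o_def] linear_compose_neg
          linear_frechet_derivative smooth_on_differentiable[OF Y x])
    moreover have "linear (\<lambda>w. G x (Y x) (lie_bracket (\<lambda>_. w) X x))"
      unfolding lie_bracket_const_left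
      by (intro linear_compose[OF _ l2[OF x], unfolded o_def]
          linear_frechet_derivative smooth_on_differentiable[OF X x])
    moreover note l1[OF x, of "lie_bracket X Y x"]
    ultimately have "linear (\<lambda>w. (1 / 2) *\<^sub>R (frechet_derivative (\<lambda>y. G y (Y y) w) (at x) (X x)
      + frechet_derivative (\<lambda>y. G y w (X y)) (at x) (Y x)
      - frechet_derivative (\<lambda>y. G y (X y) (Y y)) (at x) w
      - G x (X x) (lie_bracket Y (\<lambda>_. w) x)
      + G x (Y x) (lie_bracket (\<lambda>_. w) X x)
      + G x w (lie_bracket X Y x)))"
      by (intro linear_compose_scale_right linear_compose_add linear_compose_sub)
    then show ?thesis by (simp add: \<alpha>_def[abs_def])
  qed
  have "Ck_on k S (levi_civita G X Y)" for k
  proof (rule Ck_on_solution[OF S, where G = G and \<alpha> = \<alpha>])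
    show "G x (levi_civita G X Y x) w = \<alpha> x w" if "x \<in> S" for x w
      using sharp_works[OF _ lin[OF that]] G that
      unfolding levi_civita_def smooth_form_on_def \<alpha>_def[symmetric] by blast
  qed (use G smooth in \<open>auto simp: smooth_form_on_def smooth_on_def\<close>)
  then show ?thesis by (simp add: smooth_on_def)
qed

lemma smooth_on_local_ricci:
  assumes S: "open S" and G: "smooth_form_on S G"
  shows "smooth_on S (\<lambda>x. local_ricci G x v w)"
proof -
  \<comment> \<open>Constant fields commute, so the bracket term of the curvature becomes a
    covariant derivative along the zero field. All terms are then covered by one or two uses of
    \<open>smooth_on_levi_civita\<close>.\<close>
  have "lie_bracket (\<lambda>_. a) (\<lambda>_. b) = (\<lambda>_. 0)" for a b :: 'a
    by (simp add: lie_bracket_def fun_eq_iff)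
  then show ?thesis
    unfolding local_ricci_def trace_map_def curvature_def
    by (simp, intro smooth_on_sum smooth_on_inner_left smooth_on_diff smooth_on_levi_civita
        smooth_on_const S G)
qed

lemma smooth_on_einstein_factor:
  fixes G :: "'e::euclidean_space \<Rightarrow> 'e \<Rightarrow> 'e \<Rightarrow> real"
  assumes S: "open S" and G: "smooth_form_on S G"
    and ric: "\<And>x u w. x \<in> S \<Longrightarrow> local_ricci G x u w = \<mu> x * G x u w"
  shows "smooth_on S \<mu>"
proof -
  obtain b :: 'e where b: "b \<in> Basis" using nonempty_Basis by blast
  have "Ck_on k S (\<lambda>x. \<mu> x *\<^sub>R b)" for k
  proof (rule Ck_on_solution[OF S, where G = G and \<alpha> = "\<lambda>x w. local_ricci G x b w"])
    show "G x (\<mu> x *\<^sub>R b) w = local_ricci G x b w" if "x \<in> S" for x w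
      using linear_scale[OF smooth_form_on_linear(1)[OF G that]] ric[OF that] by simp
  qed (use G smooth_on_local_ricci[OF S G] in \<open>auto simp: smooth_form_on_def smooth_on_def\<close>)
  then have "smooth_on S (\<lambda>x. (\<mu> x *\<^sub>R b) \<bullet> b)"
    by (intro smooth_on_inner_left S) (simp add: smooth_on_def)
  then show ?thesis using b by simp
qed

section \<open>From a soliton with Killing field to an Einstein metric\<close>

lemma semi_riemannian_smooth_form:
  assumes "semi_riemannian A g"
  shows "open (chart_ran A i)" "smooth_form_on (chart_ran A i) (g i)"
  using assms unfolding semi_riemannian_def smooth_manifold_def smooth_tfield_def smooth_form_on_def
    nondegenerate_def by blast+

lemma soliton_killing_imp_einstein:
  assumes sol: "ricci_bourguignon_soliton A g X lam rho" and kil: "killing_field A g X"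
  shows "einstein A g"
proof -
  have g: "semi_riemannian A g" using sol by (simp add: ricci_bourguignon_soliton_def)
  define \<mu> where "\<mu> p = lam + rho * scalar_curvature A g p" for p
  have ric: "local_ricci (g i) x u w = \<mu> (param A i x) * g i x u w" if "x \<in> chart_ran A i" for i x u w
    using sol kil that
    by (simp add: ricci_bourguignon_soliton_def killing_field_def tensor_eq_def tensor_add_def
        tensor_scale_def ricci_def \<mu>_def distrib_right)
  have "smooth_on (chart_ran A i) (\<mu> \<circ> param A i)" for i
    by (rule smooth_on_einstein_factor[OF semi_riemannian_smooth_form[OF g]]) (simp add: ric)
  then have "smooth_fun A \<mu>" by (simp add: smooth_fun_def)
  moreover have "tensor_eq A (ricci g) (tensor_scale A \<mu> g)"
    by (simp add: tensor_eq_def ricci_def tensor_scale_def ric)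
  ultimately show ?thesis using g by (auto simp: einstein_def)
qed

section \<open>Charts of products\<close>

text \<open>The first-order part of a smooth atlas: just enough for the chain rule between charts,
  and easily inherited by products. It is used for the product of the first two factors, on which h
  lives. \<open>transforms_as_vfield\<close> isolates the transformation law of vector fields for
  the same purpose.\<close>

definition differentiable_atlas :: "('i, 'm, 'e::euclidean_space) atlas \<Rightarrow> bool" where
  "differentiable_atlas A \<longleftrightarrow>
     (\<forall>i. inj_on (coord A i) (chart_dom A i)) \<and>
     (\<forall>i j. open (overlap A i j)) \<and>
     (\<forall>i j. \<forall>x\<in>overlap A i j. transition A i j differentiable (at x))"

definition transforms_as_vfield :: "('i, 'm, 'e::euclidean_space) atlas \<Rightarrow> ('i, 'e) vfield \<Rightarrow> bool" where
  "transforms_as_vfield A X \<longleftrightarrow> (\<forall>i j. \<forall>x\<in>overlap A i j.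
     X j (transition A i j x) = frechet_derivative (transition A i j) (at x) (X i x))"

lemma smooth_manifold_differentiable_atlas:
  assumes "smooth_manifold A"
  shows "differentiable_atlas A"
proof -
  have hom: "homeomorphism (chart_dom A i) (chart_ran A i) (coord A i) (param A i)"
    and op: "open (chart_dom A i)" "open (chart_ran A i)" for i
    using assms by (auto simp: smooth_manifold_def)
  have "openin (top_of_set (chart_ran A i)) (overlap A i j)" for i j
    unfolding overlap_def
    by (rule homeomorphism_imp_open_map[OF hom]) (simp add: op openin_open_Int)
  then have "open (overlap A i j)" for i j
    using op openin_open_trans by blast
  moreover have "inj_on (coord A i) (chart_dom A i)" for i
    using hom[of i] by (metis homeomorphism_def inj_on_inverseI)
  moreover have "transition A i j differentiable (at x)" if "x \<in> overlap A i j" for i j x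
    by (rule smooth_on_differentiable[OF _ that]) (use assms in \<open>simp add: smooth_manifold_def\<close>)
  ultimately show ?thesis by (simp add: differentiable_atlas_def)
qed

lemma open_chart_ran:
  assumes "differentiable_atlas A"
  shows "open (chart_ran A i)"
proof -
  have "chart_ran A i = overlap A i i" by (simp add: chart_ran_def overlap_def)
  then show ?thesis using assms by (simp add: differentiable_atlas_def)
qed

lemma param_coord:
  "differentiable_atlas A \<Longrightarrow> p \<in> chart_dom A i \<Longrightarrow> param A i (coord A i p) = p"
  by (simp add: differentiable_atlas_def param_def inv_into_f_f)

lemma param_chart_ran:
  assumes "differentiable_atlas A" "x \<in> chart_ran A i"
  shows "param A i x \<in> chart_dom A i" "coord A i (param A i x) = x"
  using assms(2) param_coord[OF assms(1)] by (auto simp: chart_ran_def)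

text \<open>Frees \<open>vf_apply\<close> from its chosen chart j: near x the expression of f in
  chart i is its expression in chart j after the transition map, and the derivative of that map
  carries X i to X j.\<close>

lemma vf_apply_chart:
  assumes A: "differentiable_atlas A" and X: "transforms_as_vfield A X"
    and f: "\<And>j x. x \<in> chart_ran A j \<Longrightarrow> (f \<circ> param A j) differentiable (at x)"
    and x: "x \<in> chart_ran A i"
  shows "vf_apply A X f (param A i x) = frechet_derivative (f \<circ> param A i) (at x) (X i x)"
proof -
  define p j where "p = param A i x" and "j = (SOME j. p \<in> chart_dom A j)"
  have pi: "p \<in> chart_dom A i" "coord A i p = x" using param_chart_ran[OF A x] by (auto simp: p_def)
  then have pj: "p \<in> chart_dom A j" unfolding j_def by (metis someI)
  have O: "open (overlap A i j)" "x \<in> overlap A i j"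
    using A pi pj by (auto simp: differentiable_atlas_def overlap_def)
  have Tx: "transition A i j x = coord A j p"
    using pi param_coord[OF A pi(1)] by (simp add: transition_def)
  have T: "(transition A i j has_derivative frechet_derivative (transition A i j) (at x)) (at x)"
    using A O by (simp add: differentiable_atlas_def frechet_derivative_works[symmetric])
  have "(f \<circ> param A j has_derivative frechet_derivative (f \<circ> param A j) (at (coord A j p)))
     (at (transition A i j x))"
    using f[of "coord A j p" j] pj
    by (simp add: Tx frechet_derivative_works[symmetric] chart_ran_def)
  note D = diff_chain_at[OF T this]
  have eq: "(f \<circ> param A j \<circ> transition A i j) y = (f \<circ> param A i) y" if "y \<in> overlap A i j" for y
    using that param_coord[OF A] by (auto simp: overlap_def transition_def)
  have "frechet_derivative (f \<circ> param A i) (at x) =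
      frechet_derivative (f \<circ> param A j) (at (coord A j p)) \<circ> frechet_derivative (transition A i j) (at x)"
    by (rule frechet_derivative_eq[OF has_derivative_transform_within_open[OF D O eq]])
  moreover have "X j (coord A j p) = frechet_derivative (transition A i j) (at x) (X i x)"
    using X O(2) Tx unfolding transforms_as_vfield_def by metis
  ultimately have "frechet_derivative (f \<circ> param A i) (at x) (X i x) =
      frechet_derivative (f \<circ> param A j) (at (coord A j p)) (X j (coord A j p))"
    by simp
  then show ?thesis by (simp add: vf_apply_def Let_def p_def[symmetric] j_def[symmetric])
qed

section \<open>Charts, transitions and vector fields of product atlases\<close>

lemma chart_dom_prod: "chart_dom (prod_atlas A B) (i, j) = chart_dom A i \<times> chart_dom B j"
  by (simp add: chart_dom_def prod_atlas_def)

lemma coord_prod: "coord (prod_atlas A B) (i, j) = map_prod (coord A i) (coord B j)"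
  by (simp add: coord_def prod_atlas_def)

lemma chart_ran_prod: "chart_ran (prod_atlas A B) (i, j) = chart_ran A i \<times> chart_ran B j"
  by (simp add: chart_ran_def chart_dom_prod coord_prod map_prod_surj_on)

lemma overlap_prod: "overlap (prod_atlas A B) (i, j) (i', j') = overlap A i i' \<times> overlap B j j'"
  by (simp add: overlap_def chart_dom_prod coord_prod Times_Int_Times map_prod_surj_on)

lemma param_prod:
  assumes A: "differentiable_atlas A" and B: "differentiable_atlas B"
    and "x \<in> chart_ran A i" "y \<in> chart_ran B j"
  shows "param (prod_atlas A B) (i, j) (x, y) = (param A i x, param B j y)"
proof -
  obtain p q where pq: "p \<in> chart_dom A i" "x = coord A i p" "q \<in> chart_dom B j" "y = coord B j q"
    using assms(3,4) by (auto simp: chart_ran_def)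
  have "inj_on (map_prod (coord A i) (coord B j)) (chart_dom A i \<times> chart_dom B j)"
    using A B by (intro map_prod_inj_on) (auto simp: differentiable_atlas_def)
  from inv_into_f_f[OF this, of "(p, q)"] show ?thesis
    using pq param_coord[OF A] param_coord[OF B]
    by (simp add: param_def chart_dom_prod coord_prod)
qed

lemma has_derivative_comp_fst:
  "(f has_derivative D) (at x) \<Longrightarrow> ((\<lambda>p. f (fst p)) has_derivative (\<lambda>e. D (fst e))) (at (x, y))"
  by (rule has_derivative_compose[of fst fst "(x, y)" UNIV f D])
    (auto intro: bounded_linear_imp_has_derivative bounded_linear_fst)

lemma has_derivative_comp_snd:
  "(f has_derivative D) (at y) \<Longrightarrow> ((\<lambda>p. f (snd p)) has_derivative (\<lambda>e. D (snd e))) (at (x, y))"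
  by (rule has_derivative_compose[of snd snd "(x, y)" UNIV f D])
    (auto intro: bounded_linear_imp_has_derivative bounded_linear_snd)

lemma has_derivative_pair:
  assumes "(f has_derivative D) (at x)" "(g has_derivative E) (at y)"
  shows "((\<lambda>p. (f (fst p), g (snd p))) has_derivative (\<lambda>e. (D (fst e), E (snd e)))) (at (x, y))"
  by (rule has_derivative_Pair[OF has_derivative_comp_fst[OF assms(1)] has_derivative_comp_snd[OF assms(2)]])

lemma has_derivative_transition_prod:
  assumes A: "differentiable_atlas A" and B: "differentiable_atlas B"
    and x: "x \<in> overlap A i i'" and y: "y \<in> overlap B j j'"
  shows "(transition (prod_atlas A B) (i, j) (i', j') has_derivative
     (\<lambda>e. (frechet_derivative (transition A i i') (at x) (fst e),
           frechet_derivative (transition B j j') (at y) (snd e)))) (at (x, y))"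
    and "transition (prod_atlas A B) (i, j) (i', j') (x, y) = (transition A i i' x, transition B j j' y)"
proof -
  have eq: "transition (prod_atlas A B) (i, j) (i', j') p =
      (transition A i i' (fst p), transition B j j' (snd p))"
    if "p \<in> overlap A i i' \<times> overlap B j j'" for p
  proof -
    have "fst p \<in> chart_ran A i" "snd p \<in> chart_ran B j"
      using that by (auto simp: overlap_def chart_ran_def)
    then show ?thesis
      using param_prod[OF A B, of "fst p" i "snd p" j] by (simp add: transition_def coord_prod)
  qed
  show "transition (prod_atlas A B) (i, j) (i', j') (x, y) = (transition A i i' x, transition B j j' y)"
    using eq[of "(x, y)"] x y by simp
  have "((\<lambda>p. (transition A i i' (fst p), transition B j j' (snd p))) has_derivative
     (\<lambda>e. (frechet_derivative (transition A i i') (at x) (fst e),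
           frechet_derivative (transition B j j') (at y) (snd e)))) (at (x, y))"
    using A B x y
    by (intro has_derivative_pair) (auto simp: differentiable_atlas_def frechet_derivative_works[symmetric])
  then show "(transition (prod_atlas A B) (i, j) (i', j') has_derivative
     (\<lambda>e. (frechet_derivative (transition A i i') (at x) (fst e),
           frechet_derivative (transition B j j') (at y) (snd e)))) (at (x, y))"
    by (rule has_derivative_transform_within_open[of _ _ _ UNIV "overlap A i i' \<times> overlap B j j'"])
      (use A B x y eq in \<open>auto simp: differentiable_atlas_def open_Times\<close>)
qed

lemma differentiable_atlas_prod:
  assumes A: "differentiable_atlas A" and B: "differentiable_atlas B"
  shows "differentiable_atlas (prod_atlas A B)"
  unfolding differentiable_atlas_def split_paired_All
proof (intro conjI allI ballI)
  fix i j
  show "inj_on (coord (prod_atlas A B) (i, j)) (chart_dom (prod_atlas A B) (i, j))"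
    unfolding coord_prod chart_dom_prod
    using A B by (intro map_prod_inj_on) (auto simp: differentiable_atlas_def)
  fix i' j'
  show "open (overlap (prod_atlas A B) (i, j) (i', j'))"
    using A B by (simp add: overlap_prod open_Times differentiable_atlas_def)
  fix p assume "p \<in> overlap (prod_atlas A B) (i, j) (i', j')"
  then show "transition (prod_atlas A B) (i, j) (i', j') differentiable (at p)"
    using has_derivative_transition_prod(1)[OF A B, of "fst p" i i' "snd p" j j']
    by (auto simp: overlap_prod differentiable_def)
qed

text \<open>Defined through the two lifts so that unfolding gives literally the field X1 + X2 of
  condition (ii); calculations use the componentwise form \<open>vf_pair_apply\<close>.\<close>

definition vf_pair :: "('i, 'e::monoid_add) vfield \<Rightarrow> ('j, 'd::monoid_add) vfield \<Rightarrow> ('i \<times> 'j, 'e \<times> 'd) vfield" where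
  "vf_pair X Y = vf_add (lift_vf_fst X) (lift_vf_snd Y)"

lemma vf_pair_apply: "vf_pair X Y (i, j) p = (X i (fst p), Y j (snd p))"
  by (cases p) (simp add: vf_pair_def vf_add_def lift_vf_fst_def lift_vf_snd_def)

lemma transforms_as_vfield_pair:
  assumes A: "differentiable_atlas A" and B: "differentiable_atlas B"
    and X: "transforms_as_vfield A X" and Y: "transforms_as_vfield B Y"
  shows "transforms_as_vfield (prod_atlas A B) (vf_pair X Y)"
  unfolding transforms_as_vfield_def split_paired_All
proof (intro allI ballI)
  fix i j i' j' p assume "p \<in> overlap (prod_atlas A B) (i, j) (i', j')"
  then obtain x y where p: "p = (x, y)" and xy: "x \<in> overlap A i i'" "y \<in> overlap B j j'"
    by (auto simp: overlap_prod)
  show "vf_pair X Y (i', j') (transition (prod_atlas A B) (i, j) (i', j') p) =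
      frechet_derivative (transition (prod_atlas A B) (i, j) (i', j')) (at p) (vf_pair X Y (i, j) p)"
    using X Y xy
    by (simp add: p has_derivative_transition_prod(2)[OF A B xy] vf_pair_apply transforms_as_vfield_def
        frechet_derivative_eq[OF has_derivative_transition_prod(1)[OF A B xy]])
qed

section \<open>Lie derivative of a warped metric\<close>

text \<open>Needed because the soliton field is known only up to \<open>vf_eq\<close>, and because
  \<open>param\<close> of a product chart splits into its factors only on the chart range.\<close>

lemma local_lie_derivative_cong:
  assumes S: "open S" "x \<in> S" and X: "\<And>y. y \<in> S \<Longrightarrow> X y = Y y" and G: "\<And>y. y \<in> S \<Longrightarrow> G y = H y"
  shows "local_lie_derivative X G x = local_lie_derivative Y H x"
proof (intro ext)
  fix u v
  have "frechet_derivative (\<lambda>y. G y u v) (at x) = frechet_derivative (\<lambda>y. H y u v) (at x)"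
    by (rule frechet_derivative_cong_open[OF S]) (simp add: G)
  moreover have "frechet_derivative X (at x) = frechet_derivative Y (at x)"
    by (rule frechet_derivative_cong_open[OF S X])
  ultimately show "local_lie_derivative X G x u v = local_lie_derivative Y H x u v"
    using X G S(2) by (simp add: local_lie_derivative_def lie_bracket_const_right)
qed

lemma local_lie_derivative_zero_field:
  assumes "bilinear (G x)" "(\<lambda>y. G y u v) differentiable (at x)"
  shows "local_lie_derivative (\<lambda>_. 0) G x u v = 0"
  using assms
  by (simp add: local_lie_derivative_def lie_bracket_const_right bilinear_lzero bilinear_rzero
      linear_0 linear_frechet_derivative)

text \<open>The derivative of the product field is block diagonal, so the bracket terms separate
  into the two factors. The only mixed term comes from differentiating the square of \<phi> along X.
  The differentiability claim allows W to be the base metric of a further warping.\<close>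

lemma local_lie_derivative_warped:
  fixes X :: "'a::euclidean_space \<Rightarrow> 'a" and Y :: "'b::euclidean_space \<Rightarrow> 'b"
  assumes X: "X differentiable (at x)" and Y: "Y differentiable (at y)"
    and G: "\<And>a b. (\<lambda>p. G p a b) differentiable (at x)" and K: "\<And>a b. (\<lambda>p. K p a b) differentiable (at y)"
    and \<phi>: "\<phi> differentiable (at x)"
  defines "W \<equiv> \<lambda>p u v. G (fst p) (fst u) (fst v) + (\<phi> (fst p))\<^sup>2 * K (snd p) (snd u) (snd v)"
  shows "(\<lambda>p. W p u v) differentiable (at (x, y))"
    and "local_lie_derivative (\<lambda>p. (X (fst p), Y (snd p))) W (x, y) u v =
      local_lie_derivative X G x (fst u) (fst v) + (\<phi> x)\<^sup>2 * local_lie_derivative Y K y (snd u) (snd v)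
      + 2 * \<phi> x * frechet_derivative \<phi> (at x) (X x) * K y (snd u) (snd v)"
proof -
  note fd = frechet_derivative_works[THEN iffD1]
  have \<phi>2: "((\<lambda>p. (\<phi> (fst p))\<^sup>2) has_derivative
      (\<lambda>e. 2 * \<phi> x * frechet_derivative \<phi> (at x) (fst e))) (at (x, y))"
    using has_derivative_power[OF has_derivative_comp_fst[OF fd[OF \<phi>], of y], of 2]
    by (simp add: ac_simps)
  have D: "((\<lambda>p. W p u v) has_derivative (\<lambda>e.
      frechet_derivative (\<lambda>p. G p (fst u) (fst v)) (at x) (fst e) +
      ((\<phi> x)\<^sup>2 * frechet_derivative (\<lambda>p. K p (snd u) (snd v)) (at y) (snd e) +
       2 * \<phi> x * frechet_derivative \<phi> (at x) (fst e) * K y (snd u) (snd v)))) (at (x, y))"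
    unfolding W_def
    using has_derivative_mult[OF \<phi>2 has_derivative_comp_snd[where x = x, OF fd[OF K[of "snd u" "snd v"]]]]
    by (intro has_derivative_add has_derivative_comp_fst[OF fd[OF G]]) simp
  then show "(\<lambda>p. W p u v) differentiable (at (x, y))" by (auto simp: differentiable_def)
  show "local_lie_derivative (\<lambda>p. (X (fst p), Y (snd p))) W (x, y) u v =
      local_lie_derivative X G x (fst u) (fst v) + (\<phi> x)\<^sup>2 * local_lie_derivative Y K y (snd u) (snd v)
      + 2 * \<phi> x * frechet_derivative \<phi> (at x) (X x) * K y (snd u) (snd v)"
    unfolding local_lie_derivative_def lie_bracket_const_right
      frechet_derivative_eq[OF has_derivative_pair[OF fd[OF X] fd[OF Y]]] frechet_derivative_eq[OF D]
    by (simp add: W_def algebra_simps)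
qed

lemma warped_metric_chart:
  assumes "differentiable_atlas A" "differentiable_atlas B"
    and "p \<in> chart_ran (prod_atlas A B) (i, j)"
  shows "warped_metric A g f B k (i, j) p = (\<lambda>u v. g i (fst p) (fst u) (fst v) +
     ((f \<circ> param A i) (fst p))\<^sup>2 * k j (snd p) (snd u) (snd v))"
  using assms param_prod[OF assms(1,2), of "fst p" i "snd p" j]
  by (cases p) (auto simp: warped_metric_def tensor_add_def tensor_scale_def lift_tensor_fst_def
      lift_tensor_snd_def chart_ran_prod fun_eq_iff)

lemma lie_derivative_warped_metric:
  assumes A: "differentiable_atlas A" and B: "differentiable_atlas B"
    and x: "x \<in> chart_ran A i" and y: "y \<in> chart_ran B j"
    and X: "X i differentiable (at x)" and Y: "Y j differentiable (at y)"
    and g: "\<And>a b. (\<lambda>p. g i p a b) differentiable (at x)"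
    and k: "\<And>a b. (\<lambda>p. k j p a b) differentiable (at y)"
    and f: "(f \<circ> param A i) differentiable (at x)"
    and Z: "\<And>p. p \<in> chart_ran (prod_atlas A B) (i, j) \<Longrightarrow> Z (i, j) p = vf_pair X Y (i, j) p"
  shows "(\<lambda>p. warped_metric A g f B k (i, j) p u v) differentiable (at (x, y))"
    and "lie_derivative Z (warped_metric A g f B k) (i, j) (x, y) u v =
      lie_derivative X g i x (fst u) (fst v)
      + (f (param A i x))\<^sup>2 * lie_derivative Y k j y (snd u) (snd v)
      + 2 * f (param A i x) * frechet_derivative (f \<circ> param A i) (at x) (X i x) * k j y (snd u) (snd v)"
proof -
  have O: "open (chart_ran (prod_atlas A B) (i, j))" "(x, y) \<in> chart_ran (prod_atlas A B) (i, j)"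
    using open_chart_ran[OF differentiable_atlas_prod[OF A B]] x y by (auto simp: chart_ran_prod)
  note W = local_lie_derivative_warped[where X = "X i" and Y = "Y j" and G = "g i" and K = "k j", OF X Y g k f]
  show "(\<lambda>p. warped_metric A g f B k (i, j) p u v) differentiable (at (x, y))"
    by (rule differentiable_cong_open[OF O _ W(1)[of u v]]) (simp add: warped_metric_chart[OF A B])
  have "local_lie_derivative (Z (i, j)) (warped_metric A g f B k (i, j)) (x, y) =
     local_lie_derivative (\<lambda>p. (X i (fst p), Y j (snd p))) (\<lambda>p u v. g i (fst p) (fst u) (fst v) +
     ((f \<circ> param A i) (fst p))\<^sup>2 * k j (snd p) (snd u) (snd v)) (x, y)"
    by (rule local_lie_derivative_cong[OF O]) (simp_all add: Z vf_pair_apply warped_metric_chart[OF A B])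
  then show "lie_derivative Z (warped_metric A g f B k) (i, j) (x, y) u v =
      lie_derivative X g i x (fst u) (fst v)
      + (f (param A i x))\<^sup>2 * lie_derivative Y k j y (snd u) (snd v)
      + 2 * f (param A i x) * frechet_derivative (f \<circ> param A i) (at x) (X i x) * k j y (snd u) (snd v)"
    unfolding lie_derivative_def using W(2)[of u v] by simp
qed

section \<open>Logarithmic derivatives of warping functions, and zero fields\<close>

lemma ln_comp_derivative:
  fixes \<phi> :: "'a::real_normed_vector \<Rightarrow> real"
  assumes "\<phi> differentiable (at x)" "\<phi> x > 0"
  shows "(\<lambda>y. ln (\<phi> y)) differentiable (at x)"
    and "\<phi> x * frechet_derivative (\<lambda>y. ln (\<phi> y)) (at x) e = frechet_derivative \<phi> (at x) e"
proof -
  have "((\<lambda>y. ln (\<phi> y)) has_derivative (\<lambda>e. frechet_derivative \<phi> (at x) e * inverse (\<phi> x))) (at x)"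
    using assms by (auto intro!: has_derivative_ln simp: frechet_derivative_works[symmetric])
  then show "(\<lambda>y. ln (\<phi> y)) differentiable (at x)"
    "\<phi> x * frechet_derivative (\<lambda>y. ln (\<phi> y)) (at x) e = frechet_derivative \<phi> (at x) e"
    using assms(2) by (auto simp: differentiable_def frechet_derivative_eq)
qed

text \<open>In the form f X(ln f) = X(f), the term 2 f X(f) of the warped formula becomes 2 f X(ln
  f) times f, which the conformal factor -2 X(ln f) is made to cancel.\<close>

lemma vf_apply_ln_chart:
  assumes A: "differentiable_atlas A" and X: "transforms_as_vfield A X"
    and f: "\<And>j x. x \<in> chart_ran A j \<Longrightarrow> (f \<circ> param A j) differentiable (at x)"
    and pos: "\<And>p. f p > 0" and x: "x \<in> chart_ran A i"
  shows "f (param A i x) * vf_apply A X (\<lambda>p. ln (f p)) (param A i x) =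
    frechet_derivative (f \<circ> param A i) (at x) (X i x)"
proof -
  have ln: "(\<lambda>p. ln (f p)) \<circ> param A j = (\<lambda>y. ln ((f \<circ> param A j) y))" for j
    by (simp add: fun_eq_iff)
  have "vf_apply A X (\<lambda>p. ln (f p)) (param A i x) =
      frechet_derivative ((\<lambda>p. ln (f p)) \<circ> param A i) (at x) (X i x)"
    by (rule vf_apply_chart[OF A X _ x])
      (unfold ln, intro ln_comp_derivative(1) f, auto simp: pos)
  then show ?thesis
    using ln_comp_derivative(2)[OF f[OF x], of "X i x"] pos by (simp add: ln)
qed

lemma smooth_vfield_transforms: "smooth_vfield A X \<Longrightarrow> transforms_as_vfield A X"
  by (simp add: smooth_vfield_def transforms_as_vfield_def)

lemma smooth_vfield_differentiable:
  "smooth_vfield A X \<Longrightarrow> x \<in> chart_ran A i \<Longrightarrow> X i differentiable (at x)"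
  unfolding smooth_vfield_def using smooth_on_differentiable by blast

lemma smooth_fun_differentiable:
  "smooth_fun A f \<Longrightarrow> x \<in> chart_ran A i \<Longrightarrow> (f \<circ> param A i) differentiable (at x)"
  unfolding smooth_fun_def using smooth_on_differentiable by blast

lemma semi_riemannian_differentiable:
  "semi_riemannian A g \<Longrightarrow> x \<in> chart_ran A i \<Longrightarrow> (\<lambda>p. g i p u v) differentiable (at x)"
  unfolding semi_riemannian_def smooth_tfield_def
  using smooth_on_differentiable[of "chart_ran A i" "\<lambda>p. g i p u v" x] by blast

lemma lie_derivative_zero_field:
  assumes g: "semi_riemannian A g" and X: "\<And>y. y \<in> chart_ran A i \<Longrightarrow> X i y = 0"
    and x: "x \<in> chart_ran A i"
  shows "lie_derivative X g i x u v = 0"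
proof -
  have "local_lie_derivative (X i) (g i) x = local_lie_derivative (\<lambda>_. 0) (g i) x"
    by (rule local_lie_derivative_cong[OF semi_riemannian_smooth_form(1)[OF g] x X]) auto
  moreover have "bilinear (g i x)"
    using semi_riemannian_smooth_form(2)[OF g] x by (auto simp: smooth_form_on_def nondegenerate_def)
  ultimately show ?thesis
    by (simp add: lie_derivative_def
        local_lie_derivative_zero_field[where G = "g i", OF _ semi_riemannian_differentiable[OF g x]])
qed

section \<open>The sequential warped product and the three conditions\<close>

theorem theorem3p5:
  fixes A1 :: "('i1, 'm1::{t2_space, second_countable_topology}, 'e1::euclidean_space) atlas"
    and A2 :: "('i2, 'm2::{t2_space, second_countable_topology}, 'e2::euclidean_space) atlas"
    and A3 :: "('i3, 'm3::{t2_space, second_countable_topology}, 'e3::euclidean_space) atlas"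
    and g1 :: "('i1, 'e1) tfield" and g2 :: "('i2, 'e2) tfield" and g3 :: "('i3, 'e3) tfield"
    and f :: "'m1 \<Rightarrow> real" and h :: "'m1 \<times> 'm2 \<Rightarrow> real"
    and X1 :: "('i1, 'e1) vfield" and X2 :: "('i2, 'e2) vfield" and X3 :: "('i3, 'e3) vfield"
    and X :: "(('i1 \<times> 'i2) \<times> 'i3, ('e1 \<times> 'e2) \<times> 'e3) vfield"
    and lam rho :: real
  assumes "semi_riemannian A1 g1" and "semi_riemannian A2 g2" and "semi_riemannian A3 g3"
    and "smooth_fun A1 f" and "\<forall>p. f p > 0"
    and "smooth_fun (prod_atlas A1 A2) h" and "\<forall>p. h p > 0"
    and "smooth_vfield A1 X1" and "smooth_vfield A2 X2" and "smooth_vfield A3 X3"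
    and "vf_eq (seq_atlas A1 A2 A3) X
           (vf_add (vf_add (lift_vf_fst (lift_vf_fst X1)) (lift_vf_fst (lift_vf_snd X2)))
             (lift_vf_snd X3))"
    and "ricci_bourguignon_soliton (seq_atlas A1 A2 A3)
           (seq_warped_metric A1 g1 f A2 g2 h A3 g3) X lam rho"
    and "(vf_eq (seq_atlas A1 A2 A3) X (lift_vf_snd X3) \<and> killing_field A3 g3 X3)
       \<or> (killing_field A1 g1 X1
          \<and> tensor_eq (seq_atlas A1 A2 A3)
              (lift_tensor_fst (lift_tensor_snd (lie_derivative X2 g2)))
              (tensor_scale (seq_atlas A1 A2 A3)
                (\<lambda>((p1, p2), p3). - 2 * vf_apply A1 X1 (\<lambda>p. ln (f p)) p1)
                (lift_tensor_fst (lift_tensor_snd g2)))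
          \<and> tensor_eq (seq_atlas A1 A2 A3)
              (lift_tensor_snd (lie_derivative X3 g3))
              (tensor_scale (seq_atlas A1 A2 A3)
                (\<lambda>(q, p3). - 2 * vf_apply (prod_atlas A1 A2)
                   (vf_add (lift_vf_fst X1) (lift_vf_snd X2)) (\<lambda>p. ln (h p)) q)
                (lift_tensor_snd g3)))
       \<or> (vf_eq (seq_atlas A1 A2 A3) X
            (vf_add (lift_vf_fst (lift_vf_snd X2)) (lift_vf_snd X3))
          \<and> killing_field A2 g2 X2 \<and> killing_field A3 g3 X3
          \<and> (\<forall>p. vf_apply (prod_atlas A1 A2) (lift_vf_snd X2) h p = 0))"
  shows "einstein (seq_atlas A1 A2 A3) (seq_warped_metric A1 g1 f A2 g2 h A3 g3)"
proof -
  note g1 = assms(1) and g2 = assms(2) and g3 = assms(3)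
  let ?B = "prod_atlas A1 A2"
  \<comment> \<open>The field X1 + X2 on the base of the outer warping: the direction in which h is
    differentiated.\<close>
  define Y where "Y = vf_pair X1 X2"
  have A1: "differentiable_atlas A1" and A2: "differentiable_atlas A2" and A3: "differentiable_atlas A3"
    using g1 g2 g3 by (auto simp: semi_riemannian_def intro: smooth_manifold_differentiable_atlas)
  have B: "differentiable_atlas ?B" by (rule differentiable_atlas_prod[OF A1 A2])
  have tY: "transforms_as_vfield ?B Y"
    unfolding Y_def
    by (intro transforms_as_vfield_pair A1 A2 smooth_vfield_transforms assms(8,9))
  have X: "X ((i, j), k) p = ((X1 i (fst (fst p)), X2 j (snd (fst p))), X3 k (snd p))"
    if "p \<in> chart_ran (seq_atlas A1 A2 A3) ((i, j), k)" for i j k p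
    using assms(11) that
    by (cases p) (auto simp: vf_eq_def vf_add_def lift_vf_fst_def lift_vf_snd_def)
  have ran: "((x, y), z) \<in> chart_ran (seq_atlas A1 A2 A3) ((i, j), k) \<longleftrightarrow>
      x \<in> chart_ran A1 i \<and> y \<in> chart_ran A2 j \<and> z \<in> chart_ran A3 k" for i j k x y z
    by (simp add: seq_atlas_def chart_ran_prod)
  have "lie_derivative X (seq_warped_metric A1 g1 f A2 g2 h A3 g3) ((i, j), k) ((x, y), z) u v = 0"
    if x: "x \<in> chart_ran A1 i" and y: "y \<in> chart_ran A2 j" and z: "z \<in> chart_ran A3 k"
    for i j k x y z u v
  proof -
    have xy: "(x, y) \<in> chart_ran ?B (i, j)" using x y by (simp add: chart_ran_prod)
    define p where "p = param A1 i x"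
    define q where "q = param ?B (i, j) (x, y)"
    have q: "q = (p, param A2 j y)" by (simp add: q_def p_def param_prod[OF A1 A2 x y])
    have par: "param (seq_atlas A1 A2 A3) ((i, j), k) ((x, y), z) = (q, param A3 k z)"
      unfolding seq_atlas_def q_def by (rule param_prod[OF B A3 xy z])
    define df where "df = frechet_derivative (f \<circ> param A1 i) (at x) (X1 i x)"
    define dh where "dh = frechet_derivative (h \<circ> param ?B (i, j)) (at (x, y)) (Y (i, j) (x, y))"
    note dx = smooth_vfield_differentiable[OF assms(8) x] smooth_vfield_differentiable[OF assms(9) y]
      and dz = smooth_vfield_differentiable[OF assms(10) z]
      and ff = smooth_fun_differentiable[OF assms(4)] and hh = smooth_fun_differentiable[OF assms(6)]
    have dY: "Y (i, j) differentiable (at (x, y))"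
      using has_derivative_pair[OF dx[unfolded frechet_derivative_works]]
      unfolding differentiable_def Y_def vf_pair_apply[abs_def] by blast
    note inner = lie_derivative_warped_metric[where X = X1 and Y = X2 and g = g1 and k = g2 and Z = Y,
        OF A1 A2 x y dx semi_riemannian_differentiable[OF g1 x]
        semi_riemannian_differentiable[OF g2 y] ff[OF x], unfolded Y_def, OF refl, folded Y_def]
    \<comment> \<open>The outer warping has base field Y and fibre field X3. Its base term is the
      Lie derivative along Y, which \<open>inner\<close> expands into the first three
      summands.\<close>
    have lie: "lie_derivative X (seq_warped_metric A1 g1 f A2 g2 h A3 g3) ((i, j), k) ((x, y), z) u v =
        lie_derivative X1 g1 i x (fst (fst u)) (fst (fst v))
        + (f p)\<^sup>2 * lie_derivative X2 g2 j y (snd (fst u)) (snd (fst v))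
        + 2 * f p * df * g2 j y (snd (fst u)) (snd (fst v))
        + (h q)\<^sup>2 * lie_derivative X3 g3 k z (snd u) (snd v)
        + 2 * h q * dh * g3 k z (snd u) (snd v)"
      unfolding seq_warped_metric_def p_def q_def df_def dh_def inner(2)[symmetric]
      by (rule lie_derivative_warped_metric(2)[where X = Y and Y = X3
            and g = "warped_metric A1 g1 f A2 g2" and k = g3, OF B A3 xy z dY dz inner(1)
            semi_riemannian_differentiable[OF g3 z] hh[OF xy]])
        (simp add: X[unfolded seq_atlas_def] vf_pair_apply Y_def)
    \<comment> \<open>Common to (i) and (iii): a vanishing X1 removes the terms with g1 and
      \<open>df\<close>, so the two fibre Lie derivatives and \<open>dh\<close> are what each case
      has to settle.\<close>
    have X1_zero: ?thesis
      if X1: "\<And>i x. x \<in> chart_ran A1 i \<Longrightarrow> X1 i x = 0"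
        and L2: "\<And>a b. lie_derivative X2 g2 j y a b = 0" and L3: "\<And>a b. lie_derivative X3 g3 k z a b = 0"
        and dh0: "dh = 0"
    proof -
      have "df = 0"
        using linear_0[OF linear_frechet_derivative[OF ff[OF x]]] by (simp add: df_def X1[OF x])
      then show ?thesis
        using lie_derivative_zero_field[OF g1 X1 x] by (simp add: lie L2 L3 dh0)
    qed
    from assms(13) consider
        (i) "vf_eq (seq_atlas A1 A2 A3) X (lift_vf_snd X3)" "killing_field A3 g3 X3"
      | (ii) "killing_field A1 g1 X1"
          "tensor_eq (seq_atlas A1 A2 A3)
              (lift_tensor_fst (lift_tensor_snd (lie_derivative X2 g2)))
              (tensor_scale (seq_atlas A1 A2 A3)
                (\<lambda>((p1, p2), p3). - 2 * vf_apply A1 X1 (\<lambda>p. ln (f p)) p1)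
                (lift_tensor_fst (lift_tensor_snd g2)))"
          "tensor_eq (seq_atlas A1 A2 A3)
              (lift_tensor_snd (lie_derivative X3 g3))
              (tensor_scale (seq_atlas A1 A2 A3)
                (\<lambda>(q, p3). - 2 * vf_apply ?B
                   (vf_add (lift_vf_fst X1) (lift_vf_snd X2)) (\<lambda>p. ln (h p)) q)
                (lift_tensor_snd g3))"
      | (iii) "vf_eq (seq_atlas A1 A2 A3) X
            (vf_add (lift_vf_fst (lift_vf_snd X2)) (lift_vf_snd X3))"
          "killing_field A2 g2 X2" "killing_field A3 g3 X3"
          "\<forall>p. vf_apply ?B (lift_vf_snd X2) h p = 0"
      by blast
    then show ?thesis
    proof cases
      case i
      \<comment> \<open>Comparing X = X3 with X = X1 + X2 + X3 makes the other components zero. The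
        equality is one on the triple product, so z and its chart k complete the point. All charts
        are covered because a Lie derivative needs the field on a neighbourhood.\<close>
      have X12: "X1 i' x' = 0 \<and> X2 j' y' = 0"
        if "x' \<in> chart_ran A1 i'" "y' \<in> chart_ran A2 j'" for i' j' x' y'
        using i(1) X[of "((x', y'), z)" i' j' k] that z ran[of x' y' z i' j' k]
        by (auto simp: vf_eq_def lift_vf_snd_def zero_prod_def)
      show ?thesis
      proof (rule X1_zero)
        show "X1 i x = 0" if "x \<in> chart_ran A1 i" for i x using X12[OF that y] by simp
        show "lie_derivative X2 g2 j y a b = 0" for a b
          by (rule lie_derivative_zero_field[OF g2 _ y]) (use X12[OF x] in simp)
        show "lie_derivative X3 g3 k z a b = 0" for a b
          using i(2) z by (simp add: killing_field_def tensor_eq_def)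
        have "Y (i, j) (x, y) = 0" using X12[OF x y] by (simp add: Y_def vf_pair_apply zero_prod_def)
        then show "dh = 0"
          using linear_0[OF linear_frechet_derivative[OF hh[OF xy]]] by (simp add: dh_def)
      qed
    next
      case ii
      define cf where "cf = vf_apply A1 X1 (\<lambda>p. ln (f p)) p"
      define ch where "ch = vf_apply ?B Y (\<lambda>p. ln (h p)) q"
      have L1: "lie_derivative X1 g1 i x a b = 0" for a b
        using ii(1) x by (simp add: killing_field_def tensor_eq_def)
      have L2: "lie_derivative X2 g2 j y a b = - 2 * cf * g2 j y a b" for a b
      proof -
        \<comment> \<open>The hypothesis concerns lifted tensors; evaluating it on vectors tangent
          to the second factor recovers the identity on that factor.\<close>
        have "lift_tensor_fst (lift_tensor_snd (lie_derivative X2 g2)) ((i, j), k) ((x, y), z)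
            ((0, a), 0) ((0, b), 0) =
          tensor_scale (seq_atlas A1 A2 A3)
                (\<lambda>((p1, p2), p3). - 2 * vf_apply A1 X1 (\<lambda>p. ln (f p)) p1)
                (lift_tensor_fst (lift_tensor_snd g2)) ((i, j), k) ((x, y), z) ((0, a), 0) ((0, b), 0)"
          using ii(2) ran x y z unfolding tensor_eq_def by blast
        then show ?thesis
          by (simp add: lift_tensor_fst_def lift_tensor_snd_def tensor_scale_def par q cf_def)
      qed
      have L3: "lie_derivative X3 g3 k z a b = - 2 * ch * g3 k z a b" for a b
      proof -
        have "lift_tensor_snd (lie_derivative X3 g3) ((i, j), k) ((x, y), z) (0, a) (0, b) =
          tensor_scale (seq_atlas A1 A2 A3)
                (\<lambda>(q, p3). - 2 * vf_apply ?B
                   (vf_add (lift_vf_fst X1) (lift_vf_snd X2)) (\<lambda>p. ln (h p)) q)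
                (lift_tensor_snd g3) ((i, j), k) ((x, y), z) (0, a) (0, b)"
          using ii(3) ran x y z unfolding tensor_eq_def by blast
        then show ?thesis
          by (simp add: lift_tensor_snd_def tensor_scale_def par ch_def Y_def vf_pair_def)
      qed
      \<comment> \<open>With this and the analogous \<open>dh\<close>, each conformal term -2 cf (or
        -2 ch) times the squared warping function is cancelled by the derivative of that
        square.\<close>
      have df: "df = f p * cf"
        unfolding df_def cf_def p_def
        by (rule vf_apply_ln_chart[OF A1 smooth_vfield_transforms[OF assms(8)] ff _ x, symmetric])
          (use assms(5) in auto)
      have dh: "dh = h q * ch"
        unfolding dh_def ch_def q_def
        by (rule vf_apply_ln_chart[OF B tY hh _ xy, symmetric]) (use assms(7) in auto)
      show ?thesis
        unfolding lie L1 L2 L3 df dh by (simp add: power2_eq_square algebra_simps)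
    next
      case iii
      have X1: "X1 i' x' = 0" if "x' \<in> chart_ran A1 i'" for i' x'
        using iii(1) X[of "((x', y), z)" i' j k] that y z ran[of x' y z i' j k]
        by (auto simp: vf_eq_def vf_add_def lift_vf_fst_def lift_vf_snd_def zero_prod_def)
      show ?thesis
      proof (rule X1_zero[OF X1])
        show "lie_derivative X2 g2 j y a b = 0" "lie_derivative X3 g3 k z c d = 0" for a b c d
          using iii y z by (auto simp: killing_field_def tensor_eq_def)
        \<comment> \<open>Both sides use the same chosen chart c, which may differ from (i, j);
          hence X1 had to vanish in every chart. Passing to Y gives access to \<open>tY\<close>, so
          \<open>vf_apply_chart\<close> can then return to (i, j), where \<open>dh\<close> is
          defined.\<close>
        have "vf_apply ?B Y h q = vf_apply ?B (lift_vf_snd X2) h q"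
        proof -
          define c where "c = (SOME c. q \<in> chart_dom ?B c)"
          have "q \<in> chart_dom ?B (i, j)" using param_chart_ran[OF B xy] by (simp add: q_def)
          then have "q \<in> chart_dom ?B c" unfolding c_def by (rule someI)
          then have "coord ?B c q \<in> chart_ran ?B c" by (simp add: chart_ran_def)
          then have "Y c (coord ?B c q) = lift_vf_snd X2 c (coord ?B c q)"
            by (cases c, cases "coord ?B c q")
              (auto simp: chart_ran_prod Y_def vf_pair_apply lift_vf_snd_def X1)
          then show ?thesis by (simp add: vf_apply_def c_def[symmetric] Let_def)
        qed
        then show "dh = 0"
          using vf_apply_chart[OF B tY hh xy] iii(4) by (simp add: dh_def q_def)
      qed
    qed
  qed
  then have "killing_field (seq_atlas A1 A2 A3) (seq_warped_metric A1 g1 f A2 g2 h A3 g3) X"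
    unfolding killing_field_def tensor_eq_def split_paired_All
    by (auto simp: ran)
  then show ?thesis by (rule soliton_killing_imp_einstein[OF assms(12)])
qed

end
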